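(* For each $i=1,\dots,n$, let $A_i\subset\mathbb{R}^n$ be a compact set whose convex hull $\mathrm{co}\,A_i$ has a non-empty interior. Then there exists some $\mathbf{u}=(u,u_{n+1})\in S^n$ such that, for all $i=1,\dots,n$, both $A_i\cap H_{\mathbf{u}}^+$ and $A_i\cap H_{\mathbf{u}}^-$ are non-empty and $$\delta^*(u\mid \mathrm{co}\,A_i\cap H_{\mathbf{u}}^+)-\delta_*(u\mid \mathrm{co}\,A_i\cap H_{\mathbf{u}}^+)=\delta^*(u\mid \mathrm{co}\,A_i\cap H_{\mathbf{u}}^-)-\delta_*(u\mid \mathrm{co}\,A_i\cap H_{\mathbf{u}}^-).$$
   Context: $S^n$ is the unit sphere in $\mathbb{R}^{n+1}$. A point $\mathbf{u}=(u_1,\dots,u_n,u_{n+1})\in S^n$ is written $\mathbf{u}=(u,u_{n+1})$ with $u=(u_1,\dots,u_n)\in\mathbb{R}^n$, and $H_{\mathbf{u}}^+=\{x\in\mathbb{R}^n\mid\langle u,x\rangle\ge u_{n+1}\}$, $H_{\mathbf{u}}^-=\{x\in\mathbb{R}^n\mid\langle u,x\rangle\le u_{n+1}\}$, where $\langle\cdot,\cdot\rangle$ is the standard inner product of $\mathbb{R}^n$. (If $u=0$, one of these two sets is $\mathbb{R}^n$ and the other is empty.) The support function and infimum support function are $\delta^*(u\mid X):=\max_{x\in X}\langle u,x\rangle$ and $\delta_*(u\mid X):=\min_{x\in X}\langle u,x\rangle$. The expression $\mathrm{co}\,A_i\cap H_{\mathbf{u}}^{\pm}$ means $(\mathrm{co}\,A_i)\cap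 H_{\mathbf{u}}^{\pm}$. *)

theory Defs
  imports "HOL-Analysis.Analysis"
begin

text \<open>
  The space \<open>\<real>\<^sup>n\<^sup>+\<^sup>1\<close> is represented as \<open>\<real>\<^sup>n \<times> \<real>\<close>; the norm on the product type is the
  Euclidean one, so \<open>S\<^sup>n\<close> is the library's \<open>sphere 0 1\<close> in this type.  The value \<open>(u, t)\<close>
  stands for the point with first \<open>n\<close> coordinates \<open>u\<close> and last coordinate \<open>t\<close>.
\<close>

definition halfspace_pos :: "(real ^ 'n) \<times> real \<Rightarrow> (real ^ 'n) set" where
  "halfspace_pos w = {x. fst w \<bullet> x \<ge> snd w}"

definition halfspace_neg :: "(real ^ 'n) \<times> real \<Rightarrow> (real ^ 'n) set" where
  "halfspace_neg w = {x. fst w \<bullet> x \<le> snd w}"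

text \<open>
  The following are an attained maximum and minimum, not merely a supremum and an infimum;
  they are unspecified if the extremum is not attained.  It is attained whenever \<open>X\<close> is
  compact and non-empty.
\<close>

definition support_fun :: "real ^ 'n \<Rightarrow> (real ^ 'n) set \<Rightarrow> real" where
  "support_fun u X = (GREATEST m. m \<in> (\<lambda>x. u \<bullet> x) ` X)"

definition inf_support_fun :: "real ^ 'n \<Rightarrow> (real ^ 'n) set \<Rightarrow> real" where
  "inf_support_fun u X = (LEAST m. m \<in> (\<lambda>x. u \<bullet> x) ` X)"

end

theory Submission
  imports Defs
begin

text \<open>
  Write \<open>h\<^sub>i(u)\<close> for the maximum of \<open>u \<bullet> x\<close> over \<open>A\<^sub>i\<close>, so that \<open>- h\<^sub>i(- u)\<close> is the minimum.
  If \<open>t\<close> is the midpoint \<open>(h\<^sub>i(u) - h\<^sub>i(- u)) / 2\<close> of these two values, then the hyperplane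
  \<open>u \<bullet> x = t\<close> cuts \<open>co A\<^sub>i\<close> into two parts of the same width in direction \<open>u\<close>, and each
  half-space contains a point of \<open>A\<^sub>i\<close> at which an extremum is attained
  (\<open>widths_equal_if_midpoint\<close>).  One hyperplane serves all \<open>n\<close> sets as soon as the \<open>n\<close> functions
  \<open>c\<^sub>i(u) = h\<^sub>i(u) - h\<^sub>i(- u)\<close> agree at some \<open>u \<noteq> 0\<close>.  They are continuous and odd, hence so are
  their \<open>n - 1\<close> differences \<open>c\<^sub>i - c\<^sub>0\<close>, and a common zero of those on the sphere of \<open>\<real>\<^sup>n\<close> exists by
  the Borsuk--Ulam theorem (\<open>borsuk_ulam\<close>).

  Borsuk--Ulam follows by compactness from a combinatorial lemma in the manner of Tucker and Ky Fan
  (\<open>tucker_cube_boundary\<close>): label the integer points of the boundary of the cube \<open>[-m, m]\<^sup>n\<close> with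
  \<open>\<plusminus>1, \<dots>, \<plusminus>(n - 1)\<close> so that antipodal points have opposite labels; then two neighbouring points
  have opposite labels.  For otherwise one can count.  The cube is triangulated into Kuhn simplices,
  which are chains of integer points in which every coordinate increases by at most one altogether.
  A simplex has alternating labels if its labels have distinct absolute values and alternate in sign
  when listed by increasing absolute value.  A face of the cube is given by fixing some coordinates
  at \<open>\<plusminus>m\<close>; it is alternating if these signs alternate when listed by increasing coordinate.  Let
  \<open>N\<^sub>d\<close> be the number of \<open>d\<close>-simplices that span the dimension of an alternating \<open>d\<close>-face and have
  alternating labels starting with a positive one.

  The heart of the matter is that \<open>N\<^sub>d\<close> and \<open>N\<^sub>d\<^sub>-\<^sub>1\<close> have the same parity.  By antipodal symmetry one
  may, in counting \<open>N\<^sub>d\<close>, prescribe the first sign of the face and leave that of the labels open.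
  Now count the pairs of a \<open>(d - 1)\<close>-simplex with labels alternating from a positive one, and a
  \<open>d\<close>-simplex above it in a face alternating from a positive sign.  A \<open>d\<close>-simplex lies in an odd
  number of such pairs exactly if its labels alternate (\<open>odd_card_alternating_facets\<close>), and a
  \<open>(d - 1)\<close>-simplex does exactly if its face alternates (\<open>odd_card_face_extensions\<close>).  Both rest on
  the same observation on finite sequences of signs: the number of ways to delete one entry and be
  left with a sequence alternating from a given sign is odd exactly if the whole sequence
  alternates (\<open>odd_card_alternating_deletions\<close>).  Geometrically, the alternating faces form a nested
  family of spheres, each cut by the next into two antipodal halves.

  As \<open>N\<^sub>0 = 1\<close>, all \<open>N\<^sub>d\<close> with \<open>d < n\<close> are odd.  But an alternating \<open>(n - 1)\<close>-simplex has \<open>n\<close> labels of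
  distinct absolute values, whereas only \<open>n - 1\<close> values are allowed.
\<close>


section \<open>Alternating signs\<close>

text \<open>
  The signs \<open>g\<close> are listed by increasing \<open>key\<close>.  The number of smaller elements is the position in
  this list, so \<open>b\<close> is the sign in position \<open>0\<close>.
\<close>

definition alternates :: "('a \<Rightarrow> 'k::linorder) \<Rightarrow> ('a \<Rightarrow> bool) \<Rightarrow> bool \<Rightarrow> 'a set \<Rightarrow> bool" where
  "alternates key g b K \<longleftrightarrow> (\<forall>k\<in>K. g k \<longleftrightarrow> (even (card {j\<in>K. key j < key k}) \<longleftrightarrow> b))"

lemma alternates_empty [simp]: "alternates key g b {}"
  by (simp add: alternates_def)

lemma alternates_insert_min:
  assumes "finite K" and less: "\<And>k. k \<in> K \<Longrightarrow> key x < key k"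
  shows "alternates key g b (insert x K) \<longleftrightarrow> (g x \<longleftrightarrow> b) \<and> alternates key g (\<not> b) K"
proof -
  have x: "{j \<in> insert x K. key j < key x} = {}"
    using less by (auto dest: less_asym)
  have K: "card {j \<in> insert x K. key j < key k} = Suc (card {j \<in> K. key j < key k})"
    if "k \<in> K" for k
  proof -
    have "{j \<in> insert x K. key j < key k} = insert x {j \<in> K. key j < key k}"
      using less that by auto
    moreover have "x \<notin> K"
      using less by blast
    ultimately show ?thesis
      using assms(1) by simp
  qed
  have "(\<forall>k\<in>K. g k \<longleftrightarrow> (even (card {j \<in> insert x K. key j < key k}) \<longleftrightarrow> b)) \<longleftrightarrow>
      alternates key g (\<not> b) K"
    unfolding alternates_def by (rule ball_cong[OF refl]) (simp only: K even_Suc, blast)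
  then show ?thesis
    unfolding alternates_def[of _ _ _ "insert x K"] by (simp only: ball_simps(7) x) simp
qed

lemma alternates_unique:
  assumes "finite K" "K \<noteq> {}" "alternates key g b K" "alternates key g c K"
  shows "b = c"
  using assms unfolding alternates_def by blast

lemma alternates_cong:
  assumes "\<And>k. k \<in> K \<Longrightarrow> g k \<longleftrightarrow> h k"
  shows "alternates key g b K \<longleftrightarrow> alternates key h b K"
  unfolding alternates_def by (rule ball_cong[OF refl]) (simp only: assms)

lemma alternates_not: "alternates key (\<lambda>k. \<not> g k) b K \<longleftrightarrow> alternates key g (\<not> b) K"
  unfolding alternates_def by (rule ball_cong[OF refl]) blast

lemma alternates_image:
  assumes "inj_on f K"
  shows "alternates key g b (f ` K) \<longleftrightarrow> alternates (\<lambda>k. key (f k)) (\<lambda>k. g (f k)) b K"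
proof -
  have "card {j \<in> f ` K. key j < key (f k)} = card {j \<in> K. key (f j) < key (f k)}" for k
  proof -
    have "{j \<in> f ` K. key j < key (f k)} = f ` {j \<in> K. key (f j) < key (f k)}"
      by blast
    moreover have "inj_on f {j \<in> K. key (f j) < key (f k)}"
      by (rule inj_on_subset[OF assms]) blast
    ultimately show ?thesis
      by (simp only: card_image)
  qed
  then show ?thesis
    unfolding alternates_def by (simp only: ball_simps)
qed

text \<open>
  By induction on the list of signs, removing the smallest element \<open>x\<close>.  Deleting \<open>x\<close> succeeds if the
  rest alternates from \<open>b\<close>; deleting another element succeeds only if \<open>x\<close> has sign \<open>b\<close> and the rest
  with that deletion alternates from \<open>\<not> b\<close>.  If \<open>x\<close> has sign \<open>b\<close> and the rest is not empty, then by induction the second kind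
  of deletion is odd in number exactly if the rest alternates from either sign; so the total is odd
  exactly if it alternates from \<open>\<not> b\<close>, and then \<open>x\<close> prolongs it.
\<close>

lemma odd_card_alternating_deletions:
  fixes key :: "'a \<Rightarrow> 'k::linorder"
  assumes "finite K" "K \<noteq> {}" "inj_on key K"
  shows "odd (card {k\<in>K. alternates key g b (K - {k})}) \<longleftrightarrow> (\<exists>c. alternates key g c K)"
  using assms
proof (induction "card K" arbitrary: K b rule: less_induct)
  case less
  have "Min (key ` K) \<in> key ` K"
    using less.prems by simp
  then obtain x where "x \<in> K" and Min: "Min (key ` K) = key x"
    by auto
  then have x: "x \<in> K" "\<And>k. k \<in> K \<Longrightarrow> key x \<le> key k"
    using less.prems(1) by (simp_all flip: Min)
  define L where "L = K - {x}"
  have K: "K = insert x L" "x \<notin> L" and fin: "finite L"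
    using x less.prems by (auto simp: L_def)
  have lt: "key x < key k" if "k \<in> L" for k
    using x(2)[of k] that less.prems(3) x(1) unfolding L_def
    by (metis Diff_iff inj_on_eq_iff insert_iff order_le_less)
  have alt_K: "alternates key g c K \<longleftrightarrow> (g x \<longleftrightarrow> c) \<and> alternates key g (\<not> c) L" for c
    unfolding K by (rule alternates_insert_min) (use fin lt in auto)
  have alt_del: "alternates key g c (K - {k}) \<longleftrightarrow> (g x \<longleftrightarrow> c) \<and> alternates key g (\<not> c) (L - {k})"
    if "k \<in> L" for c k
  proof -
    have "K - {k} = insert x (L - {k})"
      using K that by auto
    then show ?thesis
      using alternates_insert_min[of "L - {k}" key x g c] fin lt by simp
  qed
  have "{k\<in>K. alternates key g b (K - {k})} = (if alternates key g b L then {x} else {})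
      \<union> (if g x = b then {k\<in>L. alternates key g (\<not> b) (L - {k})} else {})"
    using K alt_del by auto
  then have count: "card {k\<in>K. alternates key g b (K - {k})} = (if alternates key g b L then 1 else 0)
      + (if g x = b then card {k\<in>L. alternates key g (\<not> b) (L - {k})} else 0)"
    using fin K(2) by (auto simp: card_insert_if)
  show ?case
  proof (cases "L = {}")
    case True
    then show ?thesis
      unfolding count alt_K by auto
  next
    case False
    have "card L < card K"
      using K fin by simp
    then have IH: "odd (card {k\<in>L. alternates key g (\<not> b) (L - {k})}) \<longleftrightarrow> (\<exists>c. alternates key g c L)"
      by (rule less.hyps) (use fin False less.prems K in \<open>auto intro: inj_on_subset\<close>)
    have either: "(\<exists>c. P c) \<longleftrightarrow> P b \<or> P (\<not> b)" for P :: "bool \<Rightarrow> bool"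
      by (cases b) (auto simp: ex_bool_eq)
    have excl: "\<not> (alternates key g b L \<and> alternates key g (\<not> b) L)"
      using alternates_unique[OF fin False] by blast
    have "(\<exists>c. alternates key g c K) \<longleftrightarrow>
        (if g x = b then alternates key g (\<not> b) L else alternates key g b L)"
      unfolding alt_K either by auto
    moreover have "odd (card {k\<in>L. alternates key g (\<not> b) (L - {k})}) \<longleftrightarrow>
        alternates key g b L \<or> alternates key g (\<not> b) L"
      unfolding IH by (rule either)
    ultimately show ?thesis
      using excl unfolding count
      by (cases "g x = b"; cases "alternates key g b L"; simp only: if_True if_False even_add) auto
  qed
qed

definition alternating_labels :: "('v \<Rightarrow> int) \<Rightarrow> bool \<Rightarrow> 'v set \<Rightarrow> bool" where
  "alternating_labels l b s \<longleftrightarrow>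
     inj_on (\<lambda>v. \<bar>l v\<bar>) s \<and> alternates abs (\<lambda>k. 0 < k) b (l ` s)"

text \<open>
  If two vertices share their label, then a facet with distinct absolute values must omit one of
  them, and omitting either gives the same labels: the number is \<open>0\<close> or \<open>2\<close>.  Otherwise vertices
  correspond to labels, and the count is one of deletions from a list of signs.
\<close>

lemma odd_card_alternating_facets:
  assumes fin: "finite s" and "s \<noteq> {}"
    and compl: "\<And>v w. v \<in> s \<Longrightarrow> w \<in> s \<Longrightarrow> l v \<noteq> - l w"
  shows "odd (card {v\<in>s. alternating_labels l b (s - {v})}) \<longleftrightarrow> (\<exists>c. alternating_labels l c s)"
proof (cases "inj_on (\<lambda>v. \<bar>l v\<bar>) s")
  case True
  then have inj: "inj_on l s"
    by (metis inj_onD inj_onI)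
  have eq: "alternating_labels l b (s - {v}) \<longleftrightarrow> alternates abs (\<lambda>k. 0 < k) b (l ` s - {l v})"
    if "v \<in> s" for v
  proof -
    have "l ` (s - {v}) = l ` s - {l v}"
      using inj_on_image_set_diff[OF inj, of s "{v}"] that by simp
    moreover have "inj_on (\<lambda>v. \<bar>l v\<bar>) (s - {v})"
      by (rule inj_on_subset[OF True]) blast
    ultimately show ?thesis
      by (simp add: alternating_labels_def)
  qed
  have "l ` {v\<in>s. alternating_labels l b (s - {v})}
      = {k \<in> l ` s. alternates abs (\<lambda>k. 0 < k) b (l ` s - {k})}"
    using eq by (simp add: image_Collect image_iff set_eq_iff) blast
  then have "card {v\<in>s. alternating_labels l b (s - {v})}
      = card {k \<in> l ` s. alternates abs (\<lambda>k. 0 < k) b (l ` s - {k})}"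
    using card_image[OF inj_on_subset[OF inj], of "{v\<in>s. alternating_labels l b (s - {v})}"]
    by simp
  moreover have "inj_on abs (l ` s)"
    using True by (auto simp: inj_on_def)
  ultimately show ?thesis
    using odd_card_alternating_deletions[of "l ` s" abs "\<lambda>k. 0 < k" b] assms True
    by (simp add: alternating_labels_def)
next
  case False
  then obtain v w where vw: "v \<in> s" "w \<in> s" "v \<noteq> w" and abs_eq: "\<bar>l v\<bar> = \<bar>l w\<bar>"
    by (auto simp: inj_on_def)
  have lvw: "l v = l w"
    using abs_eq compl[OF vw(1,2)] by linarith
  define U where "U = {u\<in>s. alternating_labels l b (s - {u})}"
  have sub: "U \<subseteq> {v, w}"
    using vw abs_eq unfolding U_def alternating_labels_def inj_on_def by blast
  have mono: "alternating_labels l b (s - {y})"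
    if "x \<in> s" "y \<in> s" "x \<noteq> y" "l x = l y" "alternating_labels l b (s - {x})" for x y
  proof -
    have im: "l ` (s - {x}) = l ` (s - {y})"
    proof -
      have "l y \<in> l ` (s - {x})" "l x \<in> l ` (s - {y})"
        using that(1-3) by blast+
      then have "l x \<in> l ` (s - {x})" "l y \<in> l ` (s - {y})"
        using that(4) by simp_all
      then have "l ` insert x (s - {x}) = l ` (s - {x})" "l ` insert y (s - {y}) = l ` (s - {y})"
        by auto
      then show ?thesis
        using that(1,2) by (simp add: insert_absorb)
    qed
    have "card ((\<lambda>v. \<bar>l v\<bar>) ` (s - {x})) = card (s - {x})"
      using that card_image unfolding alternating_labels_def by blast
    moreover have "(\<lambda>v. \<bar>l v\<bar>) ` (s - {x}) = (\<lambda>v. \<bar>l v\<bar>) ` (s - {y})"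
      using im by (metis image_image)
    ultimately have "card ((\<lambda>v. \<bar>l v\<bar>) ` (s - {y})) = card (s - {y})"
      using that fin by simp
    then have "inj_on (\<lambda>v. \<bar>l v\<bar>) (s - {y})"
      using fin by (simp add: eq_card_imp_inj_on)
    then show ?thesis
      using that im by (simp add: alternating_labels_def)
  qed
  have "v \<in> U \<longleftrightarrow> w \<in> U"
    using mono[of v w] mono[of w v] vw lvw by (auto simp: U_def)
  then have "U = {} \<or> U = {v, w}"
    using sub by blast
  then have "even (card U)"
    using vw by auto
  then show ?thesis
    using False by (simp add: alternating_labels_def U_def)
qed

section \<open>Kuhn simplices in an integer grid\<close>

text \<open>
  Points of \<open>\<int>\<^sup>n\<close> are functions that vanish from \<open>n\<close> on, so that they are equal exactly if their
  first \<open>n\<close> coordinates are.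
\<close>

definition grid :: "nat \<Rightarrow> int \<Rightarrow> (nat \<Rightarrow> int) set" where
  "grid n m = {x. (\<forall>i<n. \<bar>x i\<bar> \<le> m) \<and> (\<forall>i\<ge>n. x i = 0)}"

definition kuhn_le :: "(nat \<Rightarrow> int) \<Rightarrow> (nat \<Rightarrow> int) \<Rightarrow> bool" where
  "kuhn_le x y \<longleftrightarrow> (\<forall>i. x i \<le> y i \<and> y i \<le> x i + 1)"

text \<open>
  As \<open>kuhn_le\<close> is not transitive, requiring it for any two vertices bounds the total increase of a
  coordinate along the chain by \<open>1\<close>.  The antipodal map reverses such chains, which makes this
  triangulation of the cube symmetric.
\<close>

definition kuhn_simplex :: "nat \<Rightarrow> int \<Rightarrow> (nat \<Rightarrow> int) set \<Rightarrow> bool" where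
  "kuhn_simplex n m s \<longleftrightarrow> s \<subseteq> grid n m \<and> (\<forall>x\<in>s. \<forall>y\<in>s. kuhn_le x y \<or> kuhn_le y x)"

definition moved :: "(nat \<Rightarrow> int) set \<Rightarrow> nat set" where
  "moved s = {i. \<exists>x\<in>s. \<exists>y\<in>s. x i \<noteq> y i}"

text \<open>
  The height separates the vertices of a simplex and locates them in the chain, because going up by
  \<open>kuhn_le\<close> raises it by the number of coordinates that change.
\<close>

definition height :: "nat \<Rightarrow> (nat \<Rightarrow> int) \<Rightarrow> int" where
  "height n x = (\<Sum>i<n. x i)"

lemma finite_grid: "finite (grid n m)"
proof (rule finite_subset)
  show "grid n m \<subseteq> {f. \<forall>i. (i \<in> {..<n} \<longrightarrow> f i \<in> {-m..m}) \<and> (i \<notin> {..<n} \<longrightarrow> f i = 0)}"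
    by (auto simp: grid_def abs_le_iff)
  show "finite {f. \<forall>i. (i \<in> {..<n} \<longrightarrow> f i \<in> {-m..m}) \<and> (i \<notin> {..<n} \<longrightarrow> f i = (0::int))}"
    by (rule finite_set_of_finite_funs) auto
qed

lemma kuhn_simplex_finite: "kuhn_simplex n m s \<Longrightarrow> finite s"
  unfolding kuhn_simplex_def using finite_grid finite_subset by blast

lemma kuhn_simplex_subset: "kuhn_simplex n m t \<Longrightarrow> s \<subseteq> t \<Longrightarrow> kuhn_simplex n m s"
  unfolding kuhn_simplex_def by blast

lemma moved_subset: "kuhn_simplex n m s \<Longrightarrow> moved s \<subseteq> {..<n}"
proof
  fix i assume s: "kuhn_simplex n m s" and "i \<in> moved s"
  then obtain x y where "x \<in> grid n m" "y \<in> grid n m" "x i \<noteq> y i"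
    unfolding moved_def kuhn_simplex_def by blast
  then show "i \<in> {..<n}"
    unfolding grid_def by (metis (mono_tags, lifting) lessThan_iff mem_Collect_eq not_le)
qed

lemma kuhn_le_height:
  assumes "x \<in> grid n m" "y \<in> grid n m" "kuhn_le x y"
  shows "finite {i. y i \<noteq> x i}" "height n y = height n x + int (card {i. y i \<noteq> x i})"
    "y = (\<lambda>i. x i + (if i \<in> {i. y i \<noteq> x i} then 1 else 0))"
proof -
  let ?D = "{i. y i \<noteq> x i}"
  have sub: "?D \<subseteq> {..<n}"
    using assms(1,2) unfolding grid_def by (auto, metis not_le)
  then show fin: "finite ?D"
    using finite_subset by blast
  show eq: "y = (\<lambda>i. x i + (if i \<in> ?D then 1 else 0))"
  proof
    fix i show "y i = x i + (if i \<in> ?D then 1 else 0)"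
      using assms(3) unfolding kuhn_le_def by (smt (verit) mem_Collect_eq)
  qed
  have "height n y = (\<Sum>i<n. x i + (if i \<in> ?D then 1 else 0))"
    unfolding height_def by (rule sum.cong[OF refl]) (metis eq)
  also have "\<dots> = height n x + (\<Sum>i<n. if i \<in> ?D then 1 else 0)"
    by (simp add: height_def sum.distrib)
  also have "(\<Sum>i<n. if i \<in> ?D then 1 else (0::int)) = int (card ?D)"
  proof -
    have "(\<Sum>i<n. if i \<in> ?D then 1 else (0::int)) = (\<Sum>i\<in>{..<n} \<inter> ?D. 1)"
      by (rule sum.inter_restrict[symmetric]) simp
    also have "{..<n} \<inter> ?D = ?D"
      using sub by blast
    finally show ?thesis
      by simp
  qed
  finally show "height n y = height n x + int (card ?D)" .
qed

lemma kuhn_le_height_eq: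
  assumes "x \<in> grid n m" "y \<in> grid n m" "kuhn_le x y" "height n y \<le> height n x"
  shows "x = y"
proof -
  have "card {i. y i \<noteq> x i} = 0"
    using kuhn_le_height(2)[OF assms(1-3)] assms(4) by simp
  then show ?thesis
    using kuhn_le_height(1)[OF assms(1-3)] by auto
qed

lemma kuhn_simplex_le:
  assumes "kuhn_simplex n m s" "x \<in> s" "y \<in> s" "height n x \<le> height n y"
  shows "kuhn_le x y"
proof (rule ccontr)
  assume "\<not> kuhn_le x y"
  then have "kuhn_le y x"
    using assms unfolding kuhn_simplex_def by blast
  then have "y = x"
    using kuhn_le_height_eq[of y n m x] assms unfolding kuhn_simplex_def by blast
  with \<open>\<not> kuhn_le x y\<close> \<open>kuhn_le y x\<close> show False
    by simp
qed

lemma inj_on_height: "kuhn_simplex n m s \<Longrightarrow> inj_on (height n) s"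
  by (rule inj_onI) (metis kuhn_simplex_def kuhn_simplex_le kuhn_le_height_eq order_refl subsetD)

text \<open>
  The lowest and the highest vertex differ by \<open>1\<close> precisely in the coordinates that are not constant
  on the simplex, since every coordinate is monotone along the chain.
\<close>

lemma kuhn_simplex_ends:
  assumes s: "kuhn_simplex n m s" and "s \<noteq> {}"
  obtains a z where "a \<in> s" "z \<in> s" "\<And>x. x \<in> s \<Longrightarrow> kuhn_le a x" "\<And>x. x \<in> s \<Longrightarrow> kuhn_le x z"
    "\<And>i. z i = a i + (if i \<in> moved s then 1 else 0)"
    "height n z = height n a + int (card (moved s))"
proof -
  have fin: "finite s"
    using s by (rule kuhn_simplex_finite)
  have "Min (height n ` s) \<in> height n ` s" "Max (height n ` s) \<in> height n ` s"
    using fin assms(2) by simp_all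
  then obtain a z where a: "a \<in> s" "Min (height n ` s) = height n a"
    and z: "z \<in> s" "Max (height n ` s) = height n z"
    by (metis imageE)
  have al: "kuhn_le a x" and zl: "kuhn_le x z" if "x \<in> s" for x
  proof -
    have "height n a \<le> height n x" "height n x \<le> height n z"
      using fin that by (simp_all flip: a(2) z(2))
    then show "kuhn_le a x" "kuhn_le x z"
      using kuhn_simplex_le[OF s] a(1) z(1) that by blast+
  qed
  have D: "{i. z i \<noteq> a i} = moved s"
  proof
    show "{i. z i \<noteq> a i} \<subseteq> moved s"
      using a(1) z(1) unfolding moved_def by blast
    show "moved s \<subseteq> {i. z i \<noteq> a i}"
    proof
      fix i assume "i \<in> moved s"
      then obtain x y where xy: "x \<in> s" "y \<in> s" "x i \<noteq> y i"
        unfolding moved_def by blast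
      have "a i \<le> x i" "a i \<le> y i" "x i \<le> z i" "y i \<le> z i"
        using al zl xy(1,2) unfolding kuhn_le_def by blast+
      then show "i \<in> {i. z i \<noteq> a i}"
        using xy(3) by auto
    qed
  qed
  have grid: "a \<in> grid n m" "z \<in> grid n m"
    using a z s unfolding kuhn_simplex_def by blast+
  note h = kuhn_le_height[OF grid al[OF z(1)], unfolded D]
  show ?thesis
    by (rule that[OF a(1) z(1) al zl fun_cong[OF h(3)] h(2)])
qed

text \<open>
  The heights of the vertices are distinct and lie between those of the two ends.
\<close>

lemma card_kuhn_simplex_le:
  assumes s: "kuhn_simplex n m s"
  shows "card s \<le> Suc (card (moved s))"
proof (cases "s = {}")
  case False
  obtain a z where az: "a \<in> s" "z \<in> s" "\<And>x. x \<in> s \<Longrightarrow> kuhn_le a x" "\<And>x. x \<in> s \<Longrightarrow> kuhn_le x z"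
    "height n z = height n a + int (card (moved s))"
    using kuhn_simplex_ends[OF s False] by metis
  have "height n ` s \<subseteq> {height n a..height n z}"
  proof (rule image_subsetI)
    fix x assume "x \<in> s"
    then have "kuhn_le a x" "kuhn_le x z" "x \<in> grid n m" "a \<in> grid n m" "z \<in> grid n m"
      using az s unfolding kuhn_simplex_def by blast+
    then show "height n x \<in> {height n a..height n z}"
      using kuhn_le_height(2)[of a n m x] kuhn_le_height(2)[of x n m z] by simp
  qed
  then have "card (height n ` s) \<le> card {height n a..height n z}"
    by (intro card_mono) auto
  then show ?thesis
    using card_image[OF inj_on_height[OF s]] az(5) by simp
qed simp

text \<open>
  A simplex with one vertex less than its moved coordinates permit has a single gap in the heights,
  and it is not at an end.  The neighbours of the gap differ in two coordinates, and the gap is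
  filled by raising one or the other of them first.
\<close>

lemma card_extensions_within_span:
  assumes s: "kuhn_simplex n m s" and "s \<noteq> {}" and card: "card s = card (moved s)"
  shows "card {v. v \<notin> s \<and> kuhn_simplex n m (insert v s) \<and> moved (insert v s) \<subseteq> moved s} = 2"
    (is "card ?X = 2")
proof -
  obtain a z where az: "a \<in> s" "z \<in> s" "\<And>x. x \<in> s \<Longrightarrow> kuhn_le a x" "\<And>x. x \<in> s \<Longrightarrow> kuhn_le x z"
    and z_eq: "\<And>i. z i = a i + (if i \<in> moved s then 1 else 0)"
    and hz: "height n z = height n a + int (card (moved s))"
    using kuhn_simplex_ends[OF s \<open>s \<noteq> {}\<close>] by metis
  let ?I = "{height n a..height n z}"
  have grid: "x \<in> grid n m" if "x \<in> s" for x
    using that s unfolding kuhn_simplex_def by blast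
  have sub: "height n ` s \<subseteq> ?I"
  proof (rule image_subsetI)
    fix x assume "x \<in> s"
    then show "height n x \<in> ?I"
      using kuhn_le_height(2)[of a n m x] kuhn_le_height(2)[of x n m z] az grid by simp
  qed
  have "card (?I - height n ` s) = card ?I - card (height n ` s)"
    by (rule card_Diff_subset) (use sub kuhn_simplex_finite[OF s] in auto)
  also have "\<dots> = 1"
    using card_image[OF inj_on_height[OF s]] card hz by simp
  finally obtain p where p: "?I - height n ` s = {p}"
    by (rule card_1_singletonE)
  have p_range: "height n a < p" "p < height n z"
    using p az(1,2) by (auto simp: order_less_le)
  have hit: "\<exists>x\<in>s. height n x = q" if "q \<in> ?I" "q \<noteq> p" for q
    using p that by blast
  \<comment> \<open>The unused height \<open>p\<close> lies strictly between the ends, so both of its neighbours occur.\<close>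
  obtain x where x: "x \<in> s" "height n x = p - 1"
    using hit[of "p - 1"] p_range by auto
  obtain y where y: "y \<in> s" "height n y = p + 1"
    using hit[of "p + 1"] p_range by auto
  have xy: "kuhn_le x y"
    using kuhn_simplex_le[OF s x(1) y(1)] x y by simp
  let ?D = "{i. y i \<noteq> x i}"
  note D = kuhn_le_height[OF grid[OF x(1)] grid[OF y(1)] xy]
  have "card ?D = 2"
    using D(2) x y by simp
  then obtain i j where ij: "?D = {i, j}" "i \<noteq> j"
    by (meson card_2_iff)
  have yD: "y k = x k + 1" if "k \<in> ?D" for k
    using fun_cong[OF D(3), of k] that by simp
  have D_moved: "?D \<subseteq> moved s"
    using x(1) y(1) unfolding moved_def by blast
  have mem: "x(k := x k + 1) \<in> ?X" if k: "k \<in> ?D" for k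
  proof -
    let ?v = "x(k := x k + 1)"
    have vx: "kuhn_le x ?v" and vy: "kuhn_le ?v y"
      using xy yD[OF k] unfolding kuhn_le_def by (auto simp: order_trans)
    have vg: "?v \<in> grid n m"
      using grid[OF x(1)] grid[OF y(1)] yD[OF k] k unfolding grid_def by fastforce
    have "{i. ?v i \<noteq> x i} = {k}"
      by auto
    then have hv: "height n ?v = p"
      using kuhn_le_height(2)[OF grid[OF x(1)] vg vx] x(2) by simp
    have cmp: "kuhn_le w ?v \<or> kuhn_le ?v w" if w: "w \<in> s" for w
    proof -
      have "height n w \<noteq> p"
        using p w by blast
      then consider "height n w \<le> p - 1" | "height n w \<ge> p + 1"
        by linarith
      then show ?thesis
      proof cases
        case 1
        then have "kuhn_le w x" "kuhn_le w y"
          using kuhn_simplex_le[OF s w] x y by simp_all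
        then have "kuhn_le w ?v"
          using vx vy unfolding kuhn_le_def by (meson order_trans)
        then show ?thesis ..
      next
        case 2
        then have "kuhn_le x w" "kuhn_le y w"
          using kuhn_simplex_le[OF s _ w] x y by simp_all
        then have "kuhn_le ?v w"
          using vx vy unfolding kuhn_le_def by (smt (verit))
        then show ?thesis ..
      qed
    qed
    have refl: "kuhn_le ?v ?v"
      by (simp add: kuhn_le_def)
    have "kuhn_simplex n m (insert ?v s)"
      using s vg cmp refl unfolding kuhn_simplex_def by blast
    moreover have "moved (insert ?v s) \<subseteq> moved s"
    proof
      fix l assume l: "l \<in> moved (insert ?v s)"
      show "l \<in> moved s"
      proof (rule ccontr)
        assume nl: "l \<notin> moved s"
        then have const: "w l = x l" if "w \<in> s" for w
          using x(1) that unfolding moved_def by blast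
        have "l \<noteq> k"
          using nl D_moved k by blast
        then have same: "w l = x l" if "w \<in> insert ?v s" for w
          using const that by auto
        obtain w w' where "w \<in> insert ?v s" "w' \<in> insert ?v s" "w l \<noteq> w' l"
          using l unfolding moved_def by blast
        then show False
          by (metis same)
      qed
    qed
    moreover have "?v \<notin> s"
      using hv p by blast
    ultimately show ?thesis
      by blast
  qed
  have "v \<in> {x(i := x i + 1), x(j := x j + 1)}" if v: "v \<in> ?X" for v
  proof -
    let ?t = "insert v s"
    have t: "kuhn_simplex n m ?t" "moved ?t \<subseteq> moved s" "v \<notin> s"
      using v by blast+
    have cmp: "kuhn_le v w \<or> kuhn_le w v" if "w \<in> s" for w
      using t(1) that unfolding kuhn_simplex_def by blast
    have stay: "v k = a k" "v k = z k" if "k \<notin> moved s" for k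
      using that t(2) az(1,2) unfolding moved_def by blast+
    \<comment> \<open>If \<open>v\<close> were not between \<open>a\<close> and \<open>z\<close>, it would differ from one of them by at least \<open>2\<close> in a moved coordinate.\<close>
    have av: "kuhn_le a v"
    proof (rule ccontr)
      assume "\<not> kuhn_le a v"
      moreover then have "kuhn_le v a"
        using cmp az(1) by blast
      ultimately obtain k where k: "v k < a k"
        unfolding kuhn_le_def by (smt (verit))
      then have "k \<in> moved s"
        using stay(1)[of k] by auto
      then have "z k = a k + 1"
        using z_eq by simp
      then show False
        using cmp[OF az(2)] k unfolding kuhn_le_def by (smt (verit))
    qed
    have vz: "kuhn_le v z"
    proof (rule ccontr)
      assume "\<not> kuhn_le v z"
      moreover then have "kuhn_le z v"
        using cmp az(2) by blast
      ultimately obtain k where k: "z k < v k"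
        unfolding kuhn_le_def by (smt (verit))
      then have "k \<in> moved s"
        using stay(2)[of k] by auto
      then have "z k = a k + 1"
        using z_eq by simp
      then show False
        using cmp[OF az(1)] k unfolding kuhn_le_def by (smt (verit))
    qed
    have vg: "v \<in> grid n m"
      using t(1) unfolding kuhn_simplex_def by blast
    have "height n v \<in> ?I"
      using kuhn_le_height(2)[OF grid[OF az(1)] vg av] kuhn_le_height(2)[OF vg grid[OF az(2)] vz]
      by simp
    moreover have "height n v \<notin> height n ` s"
      using inj_on_height[OF t(1)] t(3) by (simp add: inj_on_insert)
    ultimately have hv: "height n v = p"
      using p by blast
    have xv: "kuhn_le x v" and vy: "kuhn_le v y"
      using kuhn_simplex_le[OF t(1)] hv x y by simp_all
    let ?E = "{i. v i \<noteq> x i}"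
    note E = kuhn_le_height[OF grid[OF x(1)] vg xv]
    have "card ?E = 1"
      using E(2) hv x by simp
    then obtain k where k: "?E = {k}"
      by (rule card_1_singletonE)
    have v_eq: "v = x(k := x k + 1)"
      using E(3) unfolding k by (auto simp: fun_eq_iff)
    have "x k \<noteq> v k" "v k \<le> y k"
      using k vy unfolding kuhn_le_def by auto
    then have "k \<in> ?D"
      using xv unfolding kuhn_le_def by (smt (verit) mem_Collect_eq)
    then show ?thesis
      using ij v_eq by auto
  qed
  then have "?X = {x(i := x i + 1), x(j := x j + 1)}"
    using mem ij by blast
  moreover have "x(i := x i + 1) \<noteq> x(j := x j + 1)"
    using ij(2) by (metis add_cancel_right_right fun_upd_other fun_upd_same zero_neq_one)
  ultimately show ?thesis
    by simp
qed

text \<open>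
  The chain has no gap, so a new vertex must be added at an end: lower the \<open>i\<close>-th coordinate of the
  lowest vertex, or raise that of the highest one.  One of the two leaves the cube exactly if the
  simplex lies in one of the facets \<open>x\<^sub>i = \<plusminus>m\<close>.
\<close>

lemma card_extensions_in_new_direction:
  assumes s: "kuhn_simplex n m s" and "s \<noteq> {}" and card: "card s = Suc (card (moved s))"
    and i: "i < n" "i \<notin> moved s" and c: "\<And>x. x \<in> s \<Longrightarrow> x i = c" and "m > 0"
  shows "card {v. v \<notin> s \<and> kuhn_simplex n m (insert v s) \<and> moved (insert v s) \<subseteq> insert i (moved s)}
      = (if \<bar>c\<bar> = m then 1 else 2)"
    (is "card ?X = _")
proof -
  obtain a z where az: "a \<in> s" "z \<in> s" "\<And>x. x \<in> s \<Longrightarrow> kuhn_le a x" "\<And>x. x \<in> s \<Longrightarrow> kuhn_le x z"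
    and z_eq: "\<And>i. z i = a i + (if i \<in> moved s then 1 else 0)"
    using kuhn_simplex_ends[OF s \<open>s \<noteq> {}\<close>] by metis
  have grid: "x \<in> grid n m" if "x \<in> s" for x
    using that s unfolding kuhn_simplex_def by blast
  have c_range: "\<bar>c\<bar> \<le> m"
    using grid[OF az(1)] c[OF az(1)] i unfolding grid_def by auto
  have stay: "w k = a k" "w k = z k" if "k \<notin> moved s" "w \<in> s" for k w
    using that az(1,2) unfolding moved_def by blast+
  have mem: "v \<in> ?X"
    if "v i \<noteq> c" "v \<in> grid n m" "\<And>w. w \<in> s \<Longrightarrow> kuhn_le v w \<or> kuhn_le w v"
      and st: "\<And>k. k \<noteq> i \<Longrightarrow> k \<notin> moved s \<Longrightarrow> v k = a k" for v
  proof -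
    have "kuhn_le v v"
      by (simp add: kuhn_le_def)
    then have "kuhn_simplex n m (insert v s)"
      using that(2,3) s unfolding kuhn_simplex_def by blast
    moreover have "v \<notin> s"
      using c that(1) by blast
    moreover have "moved (insert v s) \<subseteq> insert i (moved s)"
    proof
      fix k assume k: "k \<in> moved (insert v s)"
      show "k \<in> insert i (moved s)"
      proof (rule ccontr)
        assume "k \<notin> insert i (moved s)"
        then have same: "w k = a k" if "w \<in> insert v s" for w
          using that st stay(1) by auto
        obtain w w' where "w \<in> insert v s" "w' \<in> insert v s" "w k \<noteq> w' k"
          using k unfolding moved_def by blast
        then show False
          by (metis same)
      qed
    qed
    ultimately show ?thesis
      by blast
  qed
  have lower: "a(i := c - 1) \<in> ?X" if "- m < c"
  proof (rule mem)
    show "a(i := c - 1) \<in> grid n m"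
      using grid[OF az(1)] that c_range i unfolding grid_def by (auto simp: abs_le_iff)
    fix w assume "w \<in> s"
    then have "kuhn_le a w" "w i = c" "a i = c"
      using az c by auto
    then have "kuhn_le (a(i := c - 1)) w"
      unfolding kuhn_le_def by auto
    then show "kuhn_le (a(i := c - 1)) w \<or> kuhn_le w (a(i := c - 1))" ..
  qed auto
  have upper: "z(i := c + 1) \<in> ?X" if "c < m"
  proof (rule mem)
    show "z(i := c + 1) \<in> grid n m"
      using grid[OF az(2)] that c_range i unfolding grid_def by (auto simp: abs_le_iff)
    fix w assume "w \<in> s"
    then have "kuhn_le w z" "w i = c" "z i = c"
      using az c by auto
    then have "kuhn_le w (z(i := c + 1))"
      unfolding kuhn_le_def by auto
    then show "kuhn_le (z(i := c + 1)) w \<or> kuhn_le w (z(i := c + 1))" ..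
  qed (use z_eq in auto)
  have cases: "v = a(i := c - 1) \<and> - m < c \<or> v = z(i := c + 1) \<and> c < m" if v: "v \<in> ?X" for v
  proof -
    let ?t = "insert v s"
    have t: "kuhn_simplex n m ?t" "moved ?t \<subseteq> insert i (moved s)" "v \<notin> s"
      using v by blast+
    have cmp: "kuhn_le v w \<or> kuhn_le w v" if "w \<in> s" for w
      using t(1) that unfolding kuhn_simplex_def by blast
    have vg: "v \<in> grid n m"
      using t(1) unfolding kuhn_simplex_def by blast
    have v_range: "\<bar>v i\<bar> \<le> m"
      using vg i unfolding grid_def by auto
    have fin: "finite (moved s)"
      using moved_subset[OF s] finite_subset by blast
    have "card ?t = Suc (Suc (card (moved s)))"
      using card t(3) kuhn_simplex_finite[OF s] by simp
    then have "card (insert i (moved s)) \<le> card (moved ?t)"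
      using card_kuhn_simplex_le[OF t(1)] i fin by simp
    \<comment> \<open>The new simplex has too many vertices for fewer moved coordinates.\<close>
    then have "moved ?t = insert i (moved s)"
      using t(2) fin by (simp add: card_seteq)
    then obtain w w' where w: "w \<in> ?t" "w' \<in> ?t" "w i \<noteq> w' i"
      unfolding moved_def by blast
    have "v i \<noteq> c"
      using w c by (metis insertE)
    have st: "v k = a k" if "k \<noteq> i" "k \<notin> moved s" for k
      using that t(2) az(1) unfolding moved_def by blast
    from \<open>v i \<noteq> c\<close> consider "v i < c" | "v i > c"
      by linarith
    then show ?thesis
    proof cases
      case 1
      have le: "kuhn_le v w" if "w \<in> s" for w
        using cmp[OF that] c[OF that] 1 unfolding kuhn_le_def by (smt (verit))
      have "v = a(i := c - 1)"
      proof
        fix k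
        have "v k \<le> a k" "a k \<le> v k + 1" "z k \<le> v k + 1"
          using le[OF az(1)] le[OF az(2)] unfolding kuhn_le_def by blast+
        moreover have "k \<noteq> i \<Longrightarrow> k \<notin> moved s \<Longrightarrow> v k = a k"
          using st[of k] z_eq[of k] by simp
        moreover have "k \<in> moved s \<Longrightarrow> z k = a k + 1"
          using z_eq[of k] by simp
        moreover have "a i = c"
          using c az by blast
        ultimately show "v k = (a(i := c - 1)) k"
          using 1 by (cases "k = i"; cases "k \<in> moved s"; simp only: fun_upd_same fun_upd_other if_True if_False simp_thms)
      qed
      then show ?thesis
        using v_range 1 by auto
    next
      case 2
      have le: "kuhn_le w v" if "w \<in> s" for w
        using cmp[OF that] c[OF that] 2 unfolding kuhn_le_def by (smt (verit))
      have "v = z(i := c + 1)"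
      proof
        fix k
        have "z k \<le> v k" "v k \<le> z k + 1" "v k \<le> a k + 1"
          using le[OF az(1)] le[OF az(2)] unfolding kuhn_le_def by blast+
        moreover have "k \<noteq> i \<Longrightarrow> k \<notin> moved s \<Longrightarrow> v k = z k"
          using st[of k] z_eq[of k] by simp
        moreover have "k \<in> moved s \<Longrightarrow> z k = a k + 1"
          using z_eq[of k] by simp
        moreover have "z i = c"
          using c az by blast
        ultimately show "v k = (z(i := c + 1)) k"
          using 2 by (cases "k = i"; cases "k \<in> moved s"; simp only: fun_upd_same fun_upd_other if_True if_False simp_thms)
      qed
      then show ?thesis
        using v_range 2 by auto
    qed
  qed
  have X: "?X = (if - m < c then {a(i := c - 1)} else {}) \<union> (if c < m then {z(i := c + 1)} else {})"
  proof (rule set_eqI)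
    fix v
    show "v \<in> ?X \<longleftrightarrow> v \<in> (if - m < c then {a(i := c - 1)} else {}) \<union> (if c < m then {z(i := c + 1)} else {})"
      using cases[of v] lower upper by (simp only: Un_iff split: if_split) blast
  qed
  have ne: "a(i := c - 1) \<noteq> z(i := c + 1)"
  proof
    assume "a(i := c - 1) = z(i := c + 1)"
    then have "c - 1 = c + 1"
      by (metis fun_upd_same)
    then show False
      by simp
  qed
  consider "c = m" | "c = - m" | "- m < c" "c < m"
    using c_range by linarith
  then show ?thesis
    unfolding X using ne \<open>m > 0\<close> by cases auto
qed

section \<open>Alternating faces of the cube\<close>

definition fixed_coords :: "nat \<Rightarrow> int \<Rightarrow> (nat \<Rightarrow> int) set \<Rightarrow> nat set" where
  "fixed_coords n m s = {i. i < n \<and> ((\<forall>x\<in>s. x i = m) \<or> (\<forall>x\<in>s. x i = - m))}"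

text \<open>
  The smallest face of the cube around \<open>s\<close> is given by the fixed coordinates, and its dimension is
  \<open>n\<close> minus their number.  The equation says that this is also the dimension of \<open>s\<close>.
\<close>

definition alternating_face :: "nat \<Rightarrow> int \<Rightarrow> bool \<Rightarrow> (nat \<Rightarrow> int) set \<Rightarrow> bool" where
  "alternating_face n m b s \<longleftrightarrow> kuhn_simplex n m s \<and> s \<noteq> {} \<and>
     card (fixed_coords n m s) + card s = Suc n \<and>
     alternates (\<lambda>i. i) (\<lambda>i. \<forall>x\<in>s. x i = m) b (fixed_coords n m s)"

lemma not_moved: "i \<notin> moved s \<Longrightarrow> x \<in> s \<Longrightarrow> y \<in> s \<Longrightarrow> x i = y i"
  unfolding moved_def by blast

lemma fixed_coords_subset: "fixed_coords n m s \<subseteq> {..<n}"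
  unfolding fixed_coords_def by blast

lemma finite_fixed_coords: "finite (fixed_coords n m s)"
  by (rule finite_subset[OF fixed_coords_subset]) simp

lemma fixed_coords_antimono: "s \<subseteq> t \<Longrightarrow> fixed_coords n m t \<subseteq> fixed_coords n m s"
  unfolding fixed_coords_def by blast

lemma fixed_coords_not_moved: "fixed_coords n m s \<inter> moved s = {}"
proof (rule equals0I)
  fix i assume "i \<in> fixed_coords n m s \<inter> moved s"
  then obtain x y where "x \<in> s" "y \<in> s" "x i \<noteq> y i" "(\<forall>x\<in>s. x i = m) \<or> (\<forall>x\<in>s. x i = - m)"
    unfolding fixed_coords_def moved_def by blast
  then show False
    by metis
qed

lemma fixed_coords_extend:
  assumes "i \<in> fixed_coords n m s" "s \<subseteq> t" "s \<noteq> {}" "i \<notin> moved t"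
  shows "i \<in> fixed_coords n m t"
proof -
  obtain x where x: "x \<in> s"
    using assms by blast
  then have "\<forall>y\<in>t. y i = x i"
    using not_moved[OF assms(4)] assms(2) by blast
  moreover have "x i = m \<or> x i = - m" "i < n"
    using assms(1) x unfolding fixed_coords_def by blast+
  ultimately show ?thesis
    unfolding fixed_coords_def by auto
qed

lemma top_extend:
  assumes "i \<in> fixed_coords n m t" "s \<subseteq> t" "s \<noteq> {}" "m > 0"
  shows "(\<forall>x\<in>t. x i = m) \<longleftrightarrow> (\<forall>x\<in>s. x i = m)"
proof -
  obtain x where "x \<in> s"
    using assms by blast
  moreover have "(\<forall>x\<in>t. x i = m) \<or> (\<forall>x\<in>t. x i = - m)"
    using assms(1) unfolding fixed_coords_def by blast
  moreover have "m \<noteq> - m"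
    using \<open>m > 0\<close> by simp
  ultimately show ?thesis
    using assms(2) by (metis subsetD)
qed

lemma card_fixed_coords_le:
  assumes "kuhn_simplex n m s"
  shows "card (fixed_coords n m s) + card (moved s) \<le> n"
proof -
  have "finite (moved s)"
    by (rule finite_subset[OF moved_subset[OF assms]]) simp
  then have "card (fixed_coords n m s) + card (moved s) = card (fixed_coords n m s \<union> moved s)"
    using finite_fixed_coords fixed_coords_not_moved by (metis card_Un_disjoint)
  also have "\<dots> \<le> card {..<n}"
    by (rule card_mono) (use fixed_coords_subset moved_subset[OF assms] in auto)
  finally show ?thesis
    by simp
qed

text \<open>
  Let \<open>d\<close> be the number of vertices of \<open>s\<close>, so that \<open>s\<close> has at most \<open>n - d + 1\<close> fixed coordinates and
  the extensions that count have \<open>n - d\<close>.  If \<open>s\<close> has \<open>n - d + 1\<close>, then \<open>s\<close> is of full dimension in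
  its face.  An extension frees one fixed coordinate, each of them can be freed in exactly one way,
  and one counts the deletions from the list of signs of the face.  If \<open>s\<close> has \<open>n - d\<close>, then the
  extensions stay in the face of \<open>s\<close>, where \<open>s\<close> is an interior wall with a simplex on both sides.
\<close>

lemma odd_card_face_extensions:
  assumes s: "kuhn_simplex n m s" and "s \<noteq> {}" and "m > 0" and "card s \<le> n"
  shows "odd (card {v. v \<notin> s \<and> alternating_face n m b (insert v s)}) \<longleftrightarrow>
    (\<exists>c. alternating_face n m c s)"
    (is "odd (card ?Y) \<longleftrightarrow> _")
proof -
  let ?F = "fixed_coords n m"
  let ?top = "\<lambda>i. \<forall>x\<in>s. x i = m"
  have fin: "finite s" "finite (moved s)" "moved s \<subseteq> {..<n}"
    using kuhn_simplex_finite[OF s] finite_subset[OF moved_subset[OF s]] moved_subset[OF s]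
    by simp_all
  have face: "alternating_face n m b (insert v s) \<longleftrightarrow> kuhn_simplex n m (insert v s) \<and>
      card (?F (insert v s)) + card s = n \<and> alternates (\<lambda>i. i) ?top b (?F (insert v s))"
    if "v \<notin> s" for v
  proof -
    have "alternates (\<lambda>i. i) (\<lambda>i. \<forall>x\<in>insert v s. x i = m) b (?F (insert v s)) \<longleftrightarrow>
        alternates (\<lambda>i. i) ?top b (?F (insert v s))"
      by (rule alternates_cong, rule top_extend) (use assms in auto)
    then show ?thesis
      using fin that by (simp add: alternating_face_def)
  qed
  have sub: "?F (insert v s) \<subseteq> ?F s" for v
    by (rule fixed_coords_antimono) blast
  have grow: "card s \<le> card (moved (insert v s))"
    if "v \<notin> s" "kuhn_simplex n m (insert v s)" for v
    using card_kuhn_simplex_le[OF that(2)] that(1) fin by simp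
  have le: "card s \<le> Suc (card (moved s))" "card (?F s) + card (moved s) \<le> n"
    using card_kuhn_simplex_le[OF s] card_fixed_coords_le[OF s] by auto
  have F_Int: "?F s \<inter> moved s = {}"
    by (rule fixed_coords_not_moved)
  have card_compl: "card ({..<n} - ?F s) = n - card (?F s)"
    using card_Diff_subset[OF finite_fixed_coords fixed_coords_subset] by simp
  have moved_sub: "moved s \<subseteq> {..<n} - ?F s"
    using fin F_Int by blast
  consider "card (?F s) + card s = Suc n" | "card (?F s) + card s = n" | "card (?F s) + card s < n"
    using le by linarith
  then show ?thesis
  proof cases
    case 1
    define K where "K = {i\<in>?F s. alternates (\<lambda>i. i) ?top b (?F s - {i})}"
    define X where "X i = {v. v \<notin> s \<and> kuhn_simplex n m (insert v s) \<and>
        moved (insert v s) \<subseteq> insert i (moved s)}" for i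
    have "card s = Suc (card (moved s))"
      using 1 le by linarith
    have moved_eq: "moved s = {..<n} - ?F s"
      by (rule card_seteq[OF _ moved_sub]) (use 1 le card_compl in auto)
    \<comment> \<open>Freeing \<open>i\<close> is possible in one way only, since \<open>s\<close> lies in the facet \<open>x\<^sub>i = \<plusminus>m\<close>.\<close>
    have card_X: "card (X i) = 1" if i: "i \<in> ?F s" for i
    proof -
      obtain x where x: "x \<in> s"
        using \<open>s \<noteq> {}\<close> by blast
      have i': "i < n" "i \<notin> moved s"
        using i F_Int fixed_coords_subset by blast+
      have "\<bar>x i\<bar> = m"
        using i x \<open>m > 0\<close> unfolding fixed_coords_def by auto
      moreover have "card (X i) = (if \<bar>x i\<bar> = m then 1 else 2)"
        unfolding X_def
        by (rule card_extensions_in_new_direction[OF s \<open>s \<noteq> {}\<close> \<open>card s = _\<close> i'])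
          (use not_moved[OF i'(2) _ x] \<open>m > 0\<close> in auto)
      ultimately show ?thesis
        by simp
    qed
    have moved_X: "moved (insert v s) = insert i (moved s)" if "v \<in> X i" "i \<in> ?F s" for v i
    proof (rule card_seteq)
      show "card (insert i (moved s)) \<le> card (moved (insert v s))"
        using that grow[of v] fin(2) F_Int \<open>card s = _\<close> by (auto simp: X_def card_insert_if)
    qed (use that fin in \<open>auto simp: X_def\<close>)
    have F_X: "?F (insert v s) = ?F s - {i}" if v: "v \<in> X i" "i \<in> ?F s" for v i
    proof
      show "?F (insert v s) \<subseteq> ?F s - {i}"
        using sub[of v] fixed_coords_not_moved[of n m "insert v s"] moved_X[OF v] by blast
      show "?F s - {i} \<subseteq> ?F (insert v s)"
      proof
        fix j assume j: "j \<in> ?F s - {i}"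
        then have "j \<notin> moved (insert v s)"
          using moved_X[OF v] F_Int by blast
        then show "j \<in> ?F (insert v s)"
          using fixed_coords_extend[of j n m s "insert v s"] j \<open>s \<noteq> {}\<close> by blast
      qed
    qed
    have "?Y = (\<Union>i\<in>K. X i)"
    proof
      show "(\<Union>i\<in>K. X i) \<subseteq> ?Y"
      proof
        fix v assume "v \<in> (\<Union>i\<in>K. X i)"
        then obtain i where i: "i \<in> K" and v: "v \<in> X i"
          by blast
        have iF: "i \<in> ?F s" and alt: "alternates (\<lambda>i. i) ?top b (?F s - {i})"
          using i unfolding K_def by blast+
        have "card (?F s - {i}) + card s = n"
          using iF 1 finite_fixed_coords[of n m s] by (simp add: card_Diff_singleton_if card_gt_0_iff) (metis Suc_pred add_Suc card_gt_0_iff empty_iff nat.inject)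
        then show "v \<in> ?Y"
          using face[of v] F_X[OF v iF] alt v unfolding X_def by simp
      qed
      show "?Y \<subseteq> (\<Union>i\<in>K. X i)"
      proof
        fix v assume "v \<in> ?Y"
        then have v: "v \<notin> s" "kuhn_simplex n m (insert v s)" "card (?F (insert v s)) + card s = n"
          "alternates (\<lambda>i. i) ?top b (?F (insert v s))"
          using face by blast+
        have "card (?F s - ?F (insert v s)) = 1"
          using card_Diff_subset[OF finite_fixed_coords sub] 1 v(3) by simp
        then obtain i where "?F s - ?F (insert v s) = {i}"
          by (rule card_1_singletonE)
        then have i: "i \<in> ?F s" "?F (insert v s) = ?F s - {i}"
          using sub[of v] by blast+
        have "moved (insert v s) \<subseteq> insert i (moved s)"
          using moved_subset[OF v(2)] fixed_coords_not_moved[of n m "insert v s"]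
          unfolding i(2) moved_eq by blast
        then have "v \<in> X i" "i \<in> K"
          using v i unfolding X_def K_def by simp_all
        then show "v \<in> (\<Union>i\<in>K. X i)"
          by blast
      qed
    qed
    moreover have "card (\<Union>i\<in>K. X i) = (\<Sum>i\<in>K. card (X i))"
    proof (rule card_UN_disjoint)
      show "finite K"
        unfolding K_def using finite_fixed_coords by simp
      show "\<forall>i\<in>K. finite (X i)"
        using card_X unfolding K_def by (metis (no_types, lifting) card.infinite mem_Collect_eq zero_neq_one)
      show "\<forall>i\<in>K. \<forall>j\<in>K. i \<noteq> j \<longrightarrow> X i \<inter> X j = {}"
      proof (intro ballI impI equals0I)
        fix i j v assume "i \<in> K" "j \<in> K" "i \<noteq> j" "v \<in> X i \<inter> X j"
        then have "i \<in> ?F s" "j \<in> ?F s" "insert i (moved s) = insert j (moved s)"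
          using moved_X[of v i] moved_X[of v j] unfolding K_def by auto
        then show False
          using F_Int \<open>i \<noteq> j\<close> by blast
      qed
    qed
    moreover have "\<dots> = card K"
      using card_X by (simp add: K_def)
    ultimately have "card ?Y = card K"
      by simp
    moreover have "odd (card K) \<longleftrightarrow> (\<exists>c. alternates (\<lambda>i. i) ?top c (?F s))"
      unfolding K_def
      by (rule odd_card_alternating_deletions[OF finite_fixed_coords])
        (use 1 \<open>card s \<le> n\<close> in auto)
    ultimately show ?thesis
      using 1 s \<open>s \<noteq> {}\<close> by (simp add: alternating_face_def)
  next
    case 2
    define G where "G = {..<n} - ?F s"
    define X where "X = {v. v \<notin> s \<and> kuhn_simplex n m (insert v s) \<and> moved (insert v s) \<subseteq> G}"
    have card_G: "card G = card s"
      using 2 card_compl unfolding G_def by simp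
    \<comment> \<open>Either \<open>s\<close> moves in all free directions and has a gap, or one of them is still to be added.\<close>
    have "card X = 2"
    proof (cases "moved s = G")
      case True
      then show ?thesis
        using card_extensions_within_span[OF s \<open>s \<noteq> {}\<close>] card_G unfolding X_def by simp
    next
      case False
      have G: "moved s \<subset> G" "finite G"
        using False moved_sub unfolding G_def by auto
      then have "card (moved s) < card s"
        using psubset_card_mono card_G by metis
      then have card_s: "card s = Suc (card (moved s))"
        using le by linarith
      obtain i where i: "i \<in> G" "i \<notin> moved s"
        using G by blast
      have "insert i (moved s) = G"
        by (rule card_seteq) (use G i card_G card_s fin in auto)
      have "i < n" "i \<notin> ?F s"
        using i unfolding G_def by auto
      obtain x where x: "x \<in> s"
        using \<open>s \<noteq> {}\<close> by blast
      have "\<bar>x i\<bar> \<noteq> m"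
      proof
        assume "\<bar>x i\<bar> = m"
        then have "x i = m \<or> x i = - m"
          by linarith
        then have "(\<forall>y\<in>s. y i = m) \<or> (\<forall>y\<in>s. y i = - m)"
          using not_moved[OF i(2) _ x] by metis
        then show False
          using \<open>i \<notin> ?F s\<close> \<open>i < n\<close> unfolding fixed_coords_def by blast
      qed
      moreover have "card X = (if \<bar>x i\<bar> = m then 1 else 2)"
        unfolding X_def \<open>insert i (moved s) = G\<close>[symmetric]
        by (rule card_extensions_in_new_direction[OF s \<open>s \<noteq> {}\<close> card_s \<open>i < n\<close> i(2)])
          (use not_moved[OF i(2) _ x] \<open>m > 0\<close> in auto)
      ultimately show ?thesis
        by simp
    qed
    have same: "card (?F (insert v s)) + card s = n \<longleftrightarrow> moved (insert v s) \<subseteq> G"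
      "moved (insert v s) \<subseteq> G \<Longrightarrow> ?F (insert v s) = ?F s"
      if t: "kuhn_simplex n m (insert v s)" for v
    proof -
      show F_eq: "?F (insert v s) = ?F s" if "moved (insert v s) \<subseteq> G"
      proof
        show "?F s \<subseteq> ?F (insert v s)"
          using fixed_coords_extend[of _ n m s "insert v s"] that \<open>s \<noteq> {}\<close> unfolding G_def by blast
      qed (rule sub)
      show "card (?F (insert v s)) + card s = n \<longleftrightarrow> moved (insert v s) \<subseteq> G"
      proof
        assume "card (?F (insert v s)) + card s = n"
        then have "?F (insert v s) = ?F s"
          using 2 by (intro card_seteq[OF finite_fixed_coords sub]) simp
        then show "moved (insert v s) \<subseteq> G"
          using moved_subset[OF t] fixed_coords_not_moved[of n m "insert v s"]
          unfolding G_def by blast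
      next
        assume "moved (insert v s) \<subseteq> G"
        then show "card (?F (insert v s)) + card s = n"
          using F_eq 2 by simp
      qed
    qed
    have Y: "v \<in> ?Y \<longleftrightarrow> alternates (\<lambda>i. i) ?top b (?F s) \<and> v \<in> X" for v
    proof
      assume "v \<in> ?Y"
      then have v: "v \<notin> s" "alternating_face n m b (insert v s)"
        by blast+
      note v' = v(2)[unfolded face[OF v(1)]]
      have "moved (insert v s) \<subseteq> G"
        using same(1)[of v] v' by blast
      then show "alternates (\<lambda>i. i) ?top b (?F s) \<and> v \<in> X"
        using same(2)[of v] v(1) v' unfolding X_def by simp
    next
      assume "alternates (\<lambda>i. i) ?top b (?F s) \<and> v \<in> X"
      then have alt: "alternates (\<lambda>i. i) ?top b (?F s)"
        and v: "v \<notin> s" "kuhn_simplex n m (insert v s)" "moved (insert v s) \<subseteq> G"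
        unfolding X_def by blast+
      have "alternating_face n m b (insert v s)"
        unfolding face[OF v(1)] using same[OF v(2)] v alt by simp
      then show "v \<in> ?Y"
        using v(1) by blast
    qed
    have "?Y = X \<or> ?Y = {}"
      using Y by blast
    then have "even (card ?Y)"
      using \<open>card X = 2\<close> by (elim disjE) (simp_all only: card.empty, simp_all)
    then show ?thesis
      using 2 by (simp add: alternating_face_def)
  next
    case 3
    have "card (?F (insert v s)) + card s < n" for v
      using card_mono[OF finite_fixed_coords sub, of v] 3 by linarith
    then have "?Y = {}"
      using face by (metis (no_types, lifting) Collect_empty_eq less_irrefl)
    then have "card ?Y = 0"
      by (simp only: card.empty)
    then show ?thesis
      using 3 by (simp add: alternating_face_def)
  qed
qed

section \<open>Counting alternating simplices in alternating faces\<close>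

definition cube_boundary :: "nat \<Rightarrow> int \<Rightarrow> (nat \<Rightarrow> int) set" where
  "cube_boundary n m = {x \<in> grid n m. \<exists>i<n. \<bar>x i\<bar> = m}"

definition antipode :: "(nat \<Rightarrow> int) \<Rightarrow> nat \<Rightarrow> int" where
  "antipode x = (\<lambda>i. - x i)"

lemma antipode_antipode [simp]: "antipode (antipode x) = x"
  by (simp add: antipode_def)

lemma antipode_image_image [simp]: "antipode ` antipode ` s = s"
  by (simp add: image_image)

lemma inj_antipode: "inj_on antipode s"
  by (metis antipode_antipode inj_onI)

lemma kuhn_simplex_antipode:
  assumes "kuhn_simplex n m s"
  shows "kuhn_simplex n m (antipode ` s)"
proof -
  have "kuhn_le (antipode x) (antipode y) \<longleftrightarrow> kuhn_le y x" for x y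
    unfolding kuhn_le_def antipode_def by (intro iff_allI) linarith
  moreover have "antipode x \<in> grid n m" if "x \<in> grid n m" for x
    using that unfolding grid_def antipode_def by simp
  ultimately show ?thesis
    using assms unfolding kuhn_simplex_def by blast
qed

lemma alternating_face_antipode_imp:
  assumes "alternating_face n m b s" "m > 0"
  shows "alternating_face n m (\<not> b) (antipode ` s)"
proof -
  have s: "kuhn_simplex n m s" "s \<noteq> {}" "card (fixed_coords n m s) + card s = Suc n"
    "alternates (\<lambda>i. i) (\<lambda>i. \<forall>x\<in>s. x i = m) b (fixed_coords n m s)"
    using assms(1) unfolding alternating_face_def by blast+
  have neg: "- x = m \<longleftrightarrow> x = - m" "- x = - m \<longleftrightarrow> x = m" for x :: int
    by auto
  have F: "fixed_coords n m (antipode ` s) = fixed_coords n m s"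
    unfolding fixed_coords_def antipode_def ball_simps neg by blast
  have top: "(\<forall>x\<in>antipode ` s. x i = m) \<longleftrightarrow> \<not> (\<forall>x\<in>s. x i = m)" if "i \<in> fixed_coords n m s" for i
  proof -
    obtain x where "x \<in> s"
      using s(2) by blast
    moreover have "(\<forall>x\<in>s. x i = m) \<or> (\<forall>x\<in>s. x i = - m)"
      using that unfolding fixed_coords_def by blast
    moreover have "m \<noteq> - m"
      using assms(2) by simp
    ultimately show ?thesis
      unfolding antipode_def ball_simps neg by metis
  qed
  have "alternates (\<lambda>i. i) (\<lambda>i. \<forall>x\<in>antipode ` s. x i = m) (\<not> b) (fixed_coords n m s) \<longleftrightarrow>
      alternates (\<lambda>i. i) (\<lambda>i. \<not> (\<forall>x\<in>s. x i = m)) (\<not> b) (fixed_coords n m s)"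
    by (rule alternates_cong) (rule top)
  also have "\<dots>"
    unfolding alternates_not not_not by (rule s(4))
  finally show ?thesis
    using s kuhn_simplex_antipode[OF s(1)] card_image[OF inj_antipode, of s]
    unfolding alternating_face_def F by simp
qed

lemma alternating_labels_antipode_imp:
  assumes alt: "alternating_labels l b s"
    and odd: "\<And>x. x \<in> s \<Longrightarrow> l (antipode x) = - l x" and nz: "\<And>x. x \<in> s \<Longrightarrow> l x \<noteq> 0"
  shows "alternating_labels l (\<not> b) (antipode ` s)"
proof -
  have "inj_on (\<lambda>v. \<bar>l v\<bar>) s" and alt': "alternates abs (\<lambda>k. 0 < k) b (l ` s)"
    using alt unfolding alternating_labels_def by blast+
  have "inj_on ((\<lambda>v. \<bar>l v\<bar>) \<circ> antipode) s"
    by (rule inj_on_cong[THEN iffD1, OF _ \<open>inj_on (\<lambda>v. \<bar>l v\<bar>) s\<close>]) (simp add: odd)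
  then have inj: "inj_on (\<lambda>v. \<bar>l v\<bar>) (antipode ` s)"
    by (rule inj_on_imageI)
  have im: "l ` antipode ` s = uminus ` l ` s"
    unfolding image_image by (rule image_cong) (simp_all add: odd)
  have "alternates abs (\<lambda>k. 0 < k) (\<not> b) (uminus ` l ` s) \<longleftrightarrow>
      alternates abs (\<lambda>k. \<not> 0 < k) (\<not> b) (l ` s)"
    unfolding alternates_image[OF inj_uminus] abs_minus_cancel
    by (rule alternates_cong) (use nz in force)
  also have "\<dots>"
    unfolding alternates_not not_not by (rule alt')
  finally show ?thesis
    using inj unfolding alternating_labels_def im by blast
qed

text \<open>
  The assumption on edges will be refuted for labels of absolute value between \<open>1\<close> and \<open>n - 1\<close>.
  It includes \<open>x = y\<close>, so that no label is \<open>0\<close>.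
\<close>

locale antipodal_labelling =
  fixes n :: nat and m :: int and l :: "(nat \<Rightarrow> int) \<Rightarrow> int"
  assumes m_pos: "m > 0"
    and label_antipode: "\<And>x. x \<in> cube_boundary n m \<Longrightarrow> l (antipode x) = - l x"
    and no_complementary_edge:
      "\<And>x y. x \<in> cube_boundary n m \<Longrightarrow> y \<in> cube_boundary n m \<Longrightarrow> kuhn_le x y \<Longrightarrow> l x \<noteq> - l y"
begin

text \<open>
  This is the number \<open>N\<^sub>d\<close> of the introduction.
\<close>

definition face_count :: "nat \<Rightarrow> nat" where
  "face_count d = card {s. card s = Suc d \<and> (\<exists>b. alternating_face n m b s) \<and> alternating_labels l True s}"

lemma finite_simplices: "finite {s. kuhn_simplex n m s}"
  by (rule finite_subset[of _ "Pow (grid n m)"]) (auto simp: kuhn_simplex_def finite_grid)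

lemma fixed_coords_nonempty:
  assumes "alternating_face n m b s" "card s \<le> n"
  shows "fixed_coords n m s \<noteq> {}"
  using assms unfolding alternating_face_def by auto

lemma alternating_face_boundary:
  assumes "alternating_face n m b s" "card s \<le> n"
  shows "s \<subseteq> cube_boundary n m"
proof
  fix x assume "x \<in> s"
  moreover obtain i where "i \<in> fixed_coords n m s"
    using fixed_coords_nonempty[OF assms] by blast
  ultimately have "i < n" "\<bar>x i\<bar> = m"
    using m_pos unfolding fixed_coords_def by auto
  then show "x \<in> cube_boundary n m"
    using \<open>x \<in> s\<close> assms(1) unfolding cube_boundary_def alternating_face_def kuhn_simplex_def by blast
qed

lemma label_nonzero: "x \<in> cube_boundary n m \<Longrightarrow> l x \<noteq> 0"
  using no_complementary_edge[of x x] by (auto simp: kuhn_le_def)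

lemma face_labels_not_complementary:
  assumes "alternating_face n m b s" "card s \<le> n" "x \<in> s" "y \<in> s"
  shows "l x \<noteq> - l y"
proof -
  have "kuhn_le x y \<or> kuhn_le y x"
    using assms unfolding alternating_face_def kuhn_simplex_def by blast
  then show ?thesis
    using no_complementary_edge[of x y] no_complementary_edge[of y x]
      alternating_face_boundary[OF assms(1,2)] assms(3,4)
    by (metis minus_minus subsetD)
qed

text \<open>
  The antipodal map flips both signs \<open>b\<close> and \<open>c\<close>.  This is what allows one of them to be traded for the
  other below.
\<close>

definition labelled_faces :: "nat \<Rightarrow> bool \<Rightarrow> bool \<Rightarrow> (nat \<Rightarrow> int) set set" where
  "labelled_faces d b c = {s. card s = Suc d \<and> alternating_face n m b s \<and> alternating_labels l c s}"

lemma finite_labelled_faces: "finite (labelled_faces d b c)"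
  by (rule finite_subset[OF _ finite_simplices]) (auto simp: labelled_faces_def alternating_face_def)

lemma antipode_labelled_faces:
  assumes "d < n" "s \<in> labelled_faces d b c"
  shows "antipode ` s \<in> labelled_faces d (\<not> b) (\<not> c)"
proof -
  have s: "card s = Suc d" "alternating_face n m b s" "alternating_labels l c s"
    using assms(2) unfolding labelled_faces_def by blast+
  have "s \<subseteq> cube_boundary n m"
    using alternating_face_boundary[OF s(2)] s(1) \<open>d < n\<close> by simp
  then have "alternating_labels l (\<not> c) (antipode ` s)"
    using label_antipode label_nonzero by (intro alternating_labels_antipode_imp[OF s(3)]) blast+
  then show ?thesis
    using alternating_face_antipode_imp[OF s(2) m_pos] card_image[OF inj_antipode, of s] s(1)
    unfolding labelled_faces_def by simp
qed

lemma card_labelled_faces_antipode: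
  assumes "d < n"
  shows "card (labelled_faces d False True) = card (labelled_faces d True False)"
proof (rule bij_betw_same_card)
  show "bij_betw ((`) antipode) (labelled_faces d False True) (labelled_faces d True False)"
    by (rule bij_betw_byWitness[where f' = "(`) antipode"])
      (use antipode_labelled_faces[OF assms, of _ False True]
         antipode_labelled_faces[OF assms, of _ True False] in auto)
qed

lemma labelled_faces_disjoint:
  assumes "d < n" "(b, c) \<noteq> (b', c')"
  shows "labelled_faces d b c \<inter> labelled_faces d b' c' = {}"
proof (rule equals0I)
  fix s assume s: "s \<in> labelled_faces d b c \<inter> labelled_faces d b' c'"
  then have s': "card s = Suc d" "alternating_face n m b s" "alternating_face n m b' s"
    "alternating_labels l c s" "alternating_labels l c' s"
    unfolding labelled_faces_def by blast+
  have "finite s" "s \<noteq> {}"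
    using card_gt_0_iff[of s] s'(1) by simp_all
  then have "c = c'"
    using s'(4,5) unfolding alternating_labels_def
    by (intro alternates_unique[of "l ` s" abs "\<lambda>k. 0 < k"]) simp_all
  moreover have "b = b'"
  proof (rule alternates_unique)
    show "fixed_coords n m s \<noteq> {}"
      using fixed_coords_nonempty[OF s'(2)] s'(1) \<open>d < n\<close> by simp
    show "alternates (\<lambda>i. i) (\<lambda>i. \<forall>x\<in>s. x i = m) b (fixed_coords n m s)"
      "alternates (\<lambda>i. i) (\<lambda>i. \<forall>x\<in>s. x i = m) b' (fixed_coords n m s)"
      using s'(2,3) unfolding alternating_face_def by blast+
  qed (rule finite_fixed_coords)
  ultimately show False
    using assms(2) by blast
qed

text \<open>
  The simplices in faces starting with a negative sign and with labels starting with a positive one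
  are exchanged for their antipodes, for which it is the other way round.
\<close>

lemma face_count_eq:
  assumes "d < n"
  shows "face_count d = card {s. card s = Suc d \<and> alternating_face n m True s \<and> (\<exists>c. alternating_labels l c s)}"
proof -
  have "{s. card s = Suc d \<and> (\<exists>b. alternating_face n m b s) \<and> alternating_labels l True s}
      = labelled_faces d True True \<union> labelled_faces d False True"
    unfolding labelled_faces_def ex_bool_eq by blast
  then have "face_count d = card (labelled_faces d True True) + card (labelled_faces d False True)"
    unfolding face_count_def
    by (simp only: card_Un_disjoint finite_labelled_faces labelled_faces_disjoint[OF assms] prod.inject simp_thms)
  also have "\<dots> = card (labelled_faces d True True) + card (labelled_faces d True False)"
    by (simp only: card_labelled_faces_antipode[OF assms])
  also have "\<dots> = card (labelled_faces d True True \<union> labelled_faces d True False)"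
    by (simp only: card_Un_disjoint finite_labelled_faces labelled_faces_disjoint[OF assms] prod.inject simp_thms)
  also have "labelled_faces d True True \<union> labelled_faces d True False
      = {s. card s = Suc d \<and> alternating_face n m True s \<and> (\<exists>c. alternating_labels l c s)}"
    unfolding labelled_faces_def ex_bool_eq by blast
  finally show ?thesis .
qed

text \<open>
  Both sides are the parity of the number of pairs \<open>s \<subseteq> t\<close> with \<open>s \<in> B\<close> and \<open>t \<in> A\<close>, summed over \<open>t\<close>
  on the left and over \<open>s\<close> on the right.
\<close>

lemma face_count_step:
  assumes "Suc d < n"
  shows "odd (face_count (Suc d)) \<longleftrightarrow> odd (face_count d)"
proof -
  define A where "A = {t. card t = Suc (Suc d) \<and> alternating_face n m True t}"
  define B where "B = {s. card s = Suc d \<and> kuhn_simplex n m s \<and> alternating_labels l True s}"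
  have fin: "finite A" "finite B"
    by (rule finite_subset[OF _ finite_simplices]; auto simp: A_def B_def alternating_face_def)+
  have below: "odd (card {s\<in>B. s \<subseteq> t}) \<longleftrightarrow> (\<exists>c. alternating_labels l c t)" if t: "t \<in> A" for t
  proof -
    have t': "card t = Suc (Suc d)" "alternating_face n m True t" "kuhn_simplex n m t" "finite t" "t \<noteq> {}"
      using t kuhn_simplex_finite unfolding A_def alternating_face_def by blast+
    have "{s\<in>B. s \<subseteq> t} = (\<lambda>v. t - {v}) ` {v\<in>t. alternating_labels l True (t - {v})}" (is "?L = ?R")
    proof
      show "?L \<subseteq> ?R"
      proof
        fix s assume "s \<in> ?L"
        then have s: "s \<subseteq> t" "card s = Suc d" "alternating_labels l True s"
          unfolding B_def by blast+
        have "card (t - s) = 1"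
          using card_Diff_subset[OF finite_subset[OF s(1) t'(4)] s(1)] s(2) t'(1) by simp
        then obtain v where "t - s = {v}"
          by (rule card_1_singletonE)
        then have "v \<in> t" "s = t - {v}"
          using s(1) by blast+
        then show "s \<in> ?R"
          using s(3) by blast
      qed
      show "?R \<subseteq> ?L"
      proof (rule image_subsetI)
        fix v assume v: "v \<in> {v\<in>t. alternating_labels l True (t - {v})}"
        then have "card (t - {v}) = Suc d" "kuhn_simplex n m (t - {v})"
          using t' kuhn_simplex_subset[OF t'(3)] by auto
        then show "t - {v} \<in> ?L"
          using v unfolding B_def by blast
      qed
    qed
    moreover have "inj_on (\<lambda>v. t - {v}) {v\<in>t. alternating_labels l True (t - {v})}"
      by (rule inj_onI) blast
    ultimately have "card {s\<in>B. s \<subseteq> t} = card {v\<in>t. alternating_labels l True (t - {v})}"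
      by (simp only: card_image)
    then show ?thesis
      using odd_card_alternating_facets[OF t'(4,5), of l True]
        face_labels_not_complementary[OF t'(2)] t'(1) assms by simp
  qed
  have above: "odd (card {t\<in>A. s \<subseteq> t}) \<longleftrightarrow> (\<exists>c. alternating_face n m c s)" if s: "s \<in> B" for s
  proof -
    have s': "card s = Suc d" "kuhn_simplex n m s" "finite s" "s \<noteq> {}"
      using s kuhn_simplex_finite unfolding B_def by auto
    have "{t\<in>A. s \<subseteq> t} = (\<lambda>v. insert v s) ` {v. v \<notin> s \<and> alternating_face n m True (insert v s)}" (is "?L = ?R")
    proof
      show "?L \<subseteq> ?R"
      proof
        fix t assume "t \<in> ?L"
        then have t: "s \<subseteq> t" "card t = Suc (Suc d)" "alternating_face n m True t"
          unfolding A_def by blast+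
        have "card (t - s) = 1"
          using card_Diff_subset[OF s'(3) t(1)] s'(1) t(2) by simp
        then obtain v where "t - s = {v}"
          by (rule card_1_singletonE)
        then have "v \<notin> s" "t = insert v s"
          using t(1) by blast+
        then show "t \<in> ?R"
          using t(3) by blast
      qed
      show "?R \<subseteq> ?L"
        unfolding A_def using s' by auto
    qed
    moreover have "inj_on (\<lambda>v. insert v s) {v. v \<notin> s \<and> alternating_face n m True (insert v s)}"
      by (rule inj_onI) blast
    ultimately have "card {t\<in>A. s \<subseteq> t} = card {v. v \<notin> s \<and> alternating_face n m True (insert v s)}"
      by (simp only: card_image)
    then show ?thesis
      using odd_card_face_extensions[OF s'(2,4) m_pos, of True] s'(1) assms by simp
  qed
  have "{t\<in>A. odd (card {s\<in>B. s \<subseteq> t})}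
      = {t. card t = Suc (Suc d) \<and> alternating_face n m True t \<and> (\<exists>c. alternating_labels l c t)}"
    using below unfolding A_def by blast
  then have "odd (face_count (Suc d)) \<longleftrightarrow> odd (card {t\<in>A. odd (card {s\<in>B. s \<subseteq> t})})"
    by (simp only: face_count_eq[OF assms])
  also have "\<dots> \<longleftrightarrow> odd (\<Sum>t\<in>A. card {s\<in>B. s \<subseteq> t})"
    by (simp only: even_sum_iff[OF fin(1)])
  also have "(\<Sum>t\<in>A. card {s\<in>B. s \<subseteq> t}) = (\<Sum>s\<in>B. card {t\<in>A. s \<subseteq> t})"
    by (rule sum_multicount_gen[OF fin]) simp
  also have "odd \<dots> \<longleftrightarrow> odd (card {s\<in>B. odd (card {t\<in>A. s \<subseteq> t})})"
    by (simp only: even_sum_iff[OF fin(2)])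
  also have "{s\<in>B. odd (card {t\<in>A. s \<subseteq> t})}
      = {s. card s = Suc d \<and> (\<exists>b. alternating_face n m b s) \<and> alternating_labels l True s}"
  proof (rule set_eqI)
    fix s
    have "s \<in> B" if "card s = Suc d" "alternating_face n m b s" "alternating_labels l True s" for b
      using that unfolding B_def alternating_face_def by blast
    then show "s \<in> {s\<in>B. odd (card {t\<in>A. s \<subseteq> t})} \<longleftrightarrow>
        s \<in> {s. card s = Suc d \<and> (\<exists>b. alternating_face n m b s) \<and> alternating_labels l True s}"
      using above[of s] unfolding mem_Collect_eq B_def by blast
  qed
  finally show ?thesis
    by (simp only: face_count_def)
qed

text \<open>
  A \<open>0\<close>-dimensional alternating face is a vertex of the cube whose coordinates alternate in sign, and
  the first coordinate determines it.
\<close>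

lemma face_count_0:
  assumes "0 < n"
  shows "face_count 0 = 1"
proof -
  \<comment> \<open>The vertex \<open>(m, - m, m, \<dots>)\<close>.\<close>
  define x0 where "x0 i = (if i < n then if even i then m else - m else 0)" for i
  have below: "card {j \<in> {..<n}. j < i} = i" if "i < n" for i
  proof -
    have "{j \<in> {..<n}. j < i} = {..<i}"
      using that by auto
    then show ?thesis
      by simp
  qed
  have "alternating_labels l (l x > 0) {x}" for x
    using alternates_insert_min[of "{}" abs "l x" "\<lambda>k. 0 < k"] by (simp add: alternating_labels_def)
  then have labels: "\<exists>c. alternating_labels l c {x}" for x
    by blast
  have x0: "alternating_face n m True {x0}"
  proof -
    have "fixed_coords n m {x0} = {..<n}"
      by (auto simp: fixed_coords_def x0_def)
    moreover have "alternates (\<lambda>i. i) (\<lambda>i. \<forall>x\<in>{x0}. x i = m) True {..<n}"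
      unfolding alternates_def using below m_pos by (auto simp: x0_def)
    moreover have "x0 \<in> grid n m"
      using m_pos by (auto simp: grid_def x0_def)
    ultimately show ?thesis
      by (simp add: alternating_face_def kuhn_simplex_def kuhn_le_def)
  qed
  have uniq: "x = x0" if x: "alternating_face n m True {x}" for x
  proof
    fix i
    have "card (fixed_coords n m {x}) = n" "x \<in> grid n m"
      and alt: "alternates (\<lambda>i. i) (\<lambda>i. x i = m) True (fixed_coords n m {x})"
      using x by (simp_all add: alternating_face_def kuhn_simplex_def)
    then have F: "fixed_coords n m {x} = {..<n}"
      by (intro card_seteq fixed_coords_subset) simp_all
    show "x i = x0 i"
    proof (cases "i < n")
      case True
      then have "i \<in> fixed_coords n m {x}"
        using F by blast
      then have "x i = m \<or> x i = - m"
        unfolding fixed_coords_def by simp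
      moreover have "x i = m \<longleftrightarrow> even i"
        using alt below[OF True] True unfolding F alternates_def by simp
      ultimately show ?thesis
        using True by (auto simp: x0_def)
    next
      case False
      then show ?thesis
        using \<open>x \<in> grid n m\<close> by (simp add: grid_def x0_def)
    qed
  qed
  have "{s. card s = Suc 0 \<and> alternating_face n m True s \<and> (\<exists>c. alternating_labels l c s)} = {{x0}}"
    (is "?S = _")
  proof
    show "?S \<subseteq> {{x0}}"
    proof
      fix s assume "s \<in> ?S"
      then have "card s = 1" "alternating_face n m True s"
        by simp_all
      then show "s \<in> {{x0}}"
        using uniq by (metis card_1_singletonE insertI1)
    qed
    show "{{x0}} \<subseteq> ?S"
      using x0 labels by simp
  qed
  then show ?thesis
    unfolding face_count_eq[OF assms] by (simp only: card.empty card.insert finite.emptyI empty_iff) simp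
qed

lemma odd_face_count: "d < n \<Longrightarrow> odd (face_count d)"
proof (induction d)
  case 0
  then show ?case
    by (simp add: face_count_0)
next
  case (Suc d)
  then show ?case
    by (simp add: face_count_step)
qed

end

text \<open>
  Without such an edge, the number of alternating \<open>(n - 1)\<close>-simplices in the facets of the cube would
  be odd, but \<open>n\<close> distinct absolute values do not fit into \<open>{1..<n}\<close>.
\<close>

theorem tucker_cube_boundary:
  fixes l :: "(nat \<Rightarrow> int) \<Rightarrow> int"
  assumes "0 < n" "0 < m"
    and odd: "\<And>x. x \<in> cube_boundary n m \<Longrightarrow> l (antipode x) = - l x"
    and range: "\<And>x. x \<in> cube_boundary n m \<Longrightarrow> 1 \<le> \<bar>l x\<bar> \<and> \<bar>l x\<bar> < int n"
  obtains x y where "x \<in> cube_boundary n m" "y \<in> cube_boundary n m" "kuhn_le x y" "l x = - l y"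
proof (rule ccontr)
  assume "\<not> thesis"
  then interpret antipodal_labelling n m l
    by unfold_locales (use assms that in blast)+
  have "face_count (n - 1) \<noteq> 0"
    using odd_face_count[of "n - 1"] \<open>0 < n\<close> by (metis diff_less even_zero zero_less_one)
  then have "{s. card s = Suc (n - 1) \<and> (\<exists>b. alternating_face n m b s) \<and> alternating_labels l True s} \<noteq> {}"
    unfolding face_count_def by (metis card.empty)
  then obtain s b where s: "card s = Suc (n - 1)" "alternating_face n m b s" "alternating_labels l True s"
    by blast
  have "s \<subseteq> cube_boundary n m"
    using alternating_face_boundary[OF s(2)] s(1) \<open>0 < n\<close> by simp
  then have "(\<lambda>v. \<bar>l v\<bar>) ` s \<subseteq> {1..<int n}"
    using range by (intro image_subsetI) (simp add: subset_iff)
  then have "card ((\<lambda>v. \<bar>l v\<bar>) ` s) \<le> card {1..<int n}"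
    by (intro card_mono) simp_all
  then show False
    using s card_image[of "\<lambda>v. \<bar>l v\<bar>" s] \<open>0 < n\<close> unfolding alternating_labels_def by simp
qed

section \<open>The Borsuk--Ulam theorem\<close>

text \<open>
  Radial projection to the sphere shrinks distances far away from the origin.  This turns neighbouring
  points on the boundary of a large cube into close points of the sphere.
\<close>

lemma norm_sgn_diff_le:
  fixes x y :: "'a::real_normed_vector"
  assumes "x \<noteq> 0"
  shows "norm (sgn x - sgn y) \<le> 2 * norm (x - y) / norm x"
proof (cases "y = 0")
  case True
  then show ?thesis
    using assms by (simp add: norm_sgn)
next
  case False
  have pos: "norm x > 0" "norm y > 0"
    using assms False by simp_all
  have "sgn x - sgn y = (x - y) /\<^sub>R norm x + (1 / norm x - 1 / norm y) *\<^sub>R y"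
    by (simp add: sgn_div_norm algebra_simps inverse_eq_divide)
  then have "norm (sgn x - sgn y) \<le> norm (x - y) / norm x + \<bar>1 / norm x - 1 / norm y\<bar> * norm y"
    by (metis norm_triangle_ineq norm_scaleR abs_inverse abs_norm_cancel divide_inverse mult.commute)
  also have "\<bar>1 / norm x - 1 / norm y\<bar> * norm y = \<bar>norm y - norm x\<bar> / norm x"
  proof -
    have "1 / norm x - 1 / norm y = (norm y - norm x) / norm x / norm y"
      using pos by (simp add: field_simps)
    then show ?thesis
      using pos by (simp add: abs_divide)
  qed
  also have "\<dots> \<le> norm (x - y) / norm x"
    using norm_triangle_ineq3[of x y] pos by (simp add: divide_right_mono abs_minus_commute)
  finally show ?thesis
    by simp
qed

text \<open>
  If there is no common zero, then by compactness at every point some \<open>f k\<close> has absolute value at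
  least \<open>\<delta> > 0\<close>.  Labelling a point by the least such \<open>k\<close> with the sign of \<open>f k\<close> there, on a
  grid so fine that no \<open>f k\<close> varies by \<open>\<delta>\<close> between neighbours, contradicts the combinatorial lemma.
\<close>

theorem borsuk_ulam:
  fixes f :: "nat \<Rightarrow> real ^ 'n::finite \<Rightarrow> real"
  assumes cont: "\<And>k. k \<in> {1..<CARD('n)} \<Longrightarrow> continuous_on (sphere 0 1) (f k)"
    and odd: "\<And>k u. k \<in> {1..<CARD('n)} \<Longrightarrow> u \<in> sphere 0 1 \<Longrightarrow> f k (- u) = - f k u"
  shows "\<exists>u\<in>sphere 0 1. \<forall>k\<in>{1..<CARD('n)}. f k u = 0"
proof (rule ccontr)
  let ?n = "CARD('n)" and ?S = "sphere (0 :: real ^ 'n) 1"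
  assume "\<not> ?thesis"
  then have nonzero: "\<exists>k\<in>{1..<?n}. f k u \<noteq> 0" if "u \<in> ?S" for u
    using that by blast
  have "compact ?S" "?S \<noteq> {}"
    by simp_all
  have n_pos: "?n > 0"
    by simp
  let ?sum = "\<lambda>u. \<Sum>k=1..<?n. \<bar>f k u\<bar>"
  have "continuous_on ?S ?sum"
    using cont by (intro continuous_intros) auto
  then obtain u0 where u0: "u0 \<in> ?S" "\<And>u. u \<in> ?S \<Longrightarrow> ?sum u0 \<le> ?sum u"
    using continuous_attains_inf[OF \<open>compact ?S\<close> \<open>?S \<noteq> {}\<close>] by blast
  have "?sum u0 > 0"
  proof -
    obtain k where "k \<in> {1..<?n}" "f k u0 \<noteq> 0"
      using nonzero u0 by blast
    then show ?thesis
      by (intro sum_pos2[of _ k]) auto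
  qed
  define \<delta> where "\<delta> = ?sum u0 / ?n"
  have "\<delta> > 0"
    using \<open>?sum u0 > 0\<close> by (simp add: \<delta>_def)
  have large: "\<exists>k. k \<in> {1..<?n} \<and> \<delta> \<le> \<bar>f k u\<bar>" if u: "u \<in> ?S" for u
  proof (rule ccontr)
    assume "\<not> ?thesis"
    then have "?sum u \<le> (\<Sum>k=1..<?n. \<delta>)"
      by (intro sum_mono) force
    also have "\<dots> = (real ?n - 1) * \<delta>"
      using n_pos by (simp add: of_nat_diff)
    also have "\<dots> < real ?n * \<delta>"
      using \<open>\<delta> > 0\<close> by (simp add: algebra_simps)
    also have "\<dots> = ?sum u0"
      by (simp add: \<delta>_def)
    finally show False
      using u0(2)[OF u] by simp
  qed
  have "\<forall>k\<in>{1..<?n}. \<exists>d>0. \<forall>u\<in>?S. \<forall>v\<in>?S. dist v u < d \<longrightarrow> dist (f k v) (f k u) < \<delta>"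
    using compact_uniformly_continuous[OF cont \<open>compact ?S\<close>] \<open>\<delta> > 0\<close>
    unfolding uniformly_continuous_on_def by blast
  then obtain d where d: "\<And>k. k \<in> {1..<?n} \<Longrightarrow> d k > 0"
    "\<And>k u v. k \<in> {1..<?n} \<Longrightarrow> u \<in> ?S \<Longrightarrow> v \<in> ?S \<Longrightarrow> dist v u < d k \<Longrightarrow> dist (f k v) (f k u) < \<delta>"
    by metis
  \<comment> \<open>The \<open>1\<close> is there because the index set is empty for \<open>CARD('n) = 1\<close>.\<close>
  define e where "e = Min (insert 1 (d ` {1..<?n}))"
  have e_pos: "e > 0"
    using d(1) by (auto simp: e_def)
  have e_le: "e \<le> d k" if "k \<in> {1..<?n}" for k
    unfolding e_def by (rule Min_le) (use that in auto)
  \<comment> \<open>On the boundary, neighbouring grid points have distance at most \<open>CARD('n)\<close> and norm at least \<open>M\<close>.\<close>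
  obtain M :: nat where M: "2 * real ?n / e < real M"
    using reals_Archimedean2 by blast
  have "0 < 2 * real ?n / e"
    using e_pos by simp
  then have M_pos: "M > 0"
    using M by (cases M) simp_all
  define m where "m = int M"
  have "m > 0"
    using M_pos by (simp add: m_def)
  obtain idx :: "'n \<Rightarrow> nat" where idx: "bij_betw idx UNIV {0..<?n}"
    using ex_bij_betw_finite_nat[of "UNIV :: 'n set"] by auto
  define vec_of where "vec_of x = (\<chi> j. real_of_int (x (idx j)))" for x :: "nat \<Rightarrow> int"
  define pt where "pt x = sgn (vec_of x)" for x
  have norm_ge: "real M \<le> norm (vec_of x)" if x: "x \<in> cube_boundary ?n m" for x
  proof -
    obtain i where i: "i < ?n" "\<bar>x i\<bar> = m"
      using x unfolding cube_boundary_def by blast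
    then obtain j where "idx j = i"
      using idx unfolding bij_betw_def by (metis atLeastLessThan_iff imageE zero_le)
    then have "\<bar>vec_of x $ j\<bar> = real M"
      using i(2) by (simp add: vec_of_def m_def flip: of_int_abs)
    then show ?thesis
      using component_le_norm_cart[of "vec_of x" j] by simp
  qed
  have pt_S: "pt x \<in> ?S" if "x \<in> cube_boundary ?n m" for x
  proof -
    have "vec_of x \<noteq> 0"
      using norm_ge[OF that] M_pos by auto
    then show ?thesis
      by (simp add: pt_def norm_sgn)
  qed
  have pt_antipode: "pt (antipode x) = - pt x" for x
  proof -
    have "vec_of (antipode x) = - vec_of x"
      by (simp add: vec_of_def antipode_def vec_eq_iff)
    then show ?thesis
      by (simp add: pt_def sgn_minus)
  qed
  have pt_close: "dist (pt x) (pt y) < e"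
    if x: "x \<in> cube_boundary ?n m" and "kuhn_le x y" for x y
  proof -
    have comp: "\<bar>(vec_of x - vec_of y) $ j\<bar> \<le> 1" for j
    proof -
      have "x (idx j) \<le> y (idx j)" "y (idx j) \<le> x (idx j) + 1"
        using \<open>kuhn_le x y\<close> unfolding kuhn_le_def by blast+
      then show ?thesis
        by (simp add: vec_of_def)
    qed
    have "norm (vec_of x - vec_of y) \<le> (\<Sum>j\<in>UNIV. \<bar>(vec_of x - vec_of y) $ j\<bar>)"
      by (rule norm_le_l1_cart)
    also have "\<dots> \<le> (\<Sum>j\<in>(UNIV::'n set). 1)"
      by (rule sum_mono) (rule comp)
    finally have near: "norm (vec_of x - vec_of y) \<le> real ?n"
      by simp
    have ge: "real M \<le> norm (vec_of x)" "real M > 0"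
      using norm_ge[OF x] M_pos by auto
    then have "vec_of x \<noteq> 0"
      by auto
    then have "dist (pt x) (pt y) \<le> 2 * norm (vec_of x - vec_of y) / norm (vec_of x)"
      unfolding pt_def dist_norm by (rule norm_sgn_diff_le)
    also have "\<dots> \<le> 2 * real ?n / real M"
      using near ge by (intro frac_le) simp_all
    also have "\<dots> < e"
      using M e_pos ge(2) by (simp add: field_simps)
    finally show ?thesis .
  qed
  define pick where "pick u = (LEAST k. k \<in> {1..<?n} \<and> \<delta> \<le> \<bar>f k u\<bar>)" for u
  have pick: "pick u \<in> {1..<?n}" "\<delta> \<le> \<bar>f (pick u) u\<bar>" if "u \<in> ?S" for u
    using LeastI_ex[OF large[OF that]] unfolding pick_def by blast+
  have pick_minus: "pick (- u) = pick u" if "u \<in> ?S" for u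
  proof -
    have "k \<in> {1..<?n} \<and> \<delta> \<le> \<bar>f k (- u)\<bar> \<longleftrightarrow> k \<in> {1..<?n} \<and> \<delta> \<le> \<bar>f k u\<bar>" for k
      using odd[of k u] that by auto
    then show ?thesis
      unfolding pick_def by presburger
  qed
  define l where "l x = (if 0 < f (pick (pt x)) (pt x) then int (pick (pt x)) else - int (pick (pt x)))" for x
  have abs_l: "\<bar>l x\<bar> = int (pick (pt x))" for x
    by (simp add: l_def)
  obtain x y where xy: "x \<in> cube_boundary ?n m" "y \<in> cube_boundary ?n m" "kuhn_le x y" "l x = - l y"
  proof (rule tucker_cube_boundary[OF n_pos \<open>m > 0\<close>, of l])
    fix x assume x: "x \<in> cube_boundary ?n m"
    let ?u = "pt x"
    have u: "?u \<in> ?S"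
      by (rule pt_S[OF x])
    have "f (pick ?u) (- ?u) = - f (pick ?u) ?u" "f (pick ?u) ?u \<noteq> 0"
      using odd[OF pick(1)[OF u] u] pick(2)[OF u] \<open>\<delta> > 0\<close> by auto
    then show "l (antipode x) = - l x"
      unfolding l_def pt_antipode pick_minus[OF u] by auto
    show "1 \<le> \<bar>l x\<bar> \<and> \<bar>l x\<bar> < int ?n"
      using pick(1)[OF u] unfolding abs_l by simp
  qed
  let ?u = "pt x" and ?v = "pt y"
  have u: "?u \<in> ?S" and v: "?v \<in> ?S"
    using pt_S xy by blast+
  have same: "pick ?v = pick ?u"
    using xy(4) abs_l[of x] abs_l[of y] by simp
  define k where "k = pick ?u"
  have k: "k \<in> {1..<?n}" "\<delta> \<le> \<bar>f k ?u\<bar>" "\<delta> \<le> \<bar>f k ?v\<bar>"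
    using pick[OF u] pick[OF v] same by (simp_all add: k_def)
  have "0 < f k ?u \<longleftrightarrow> \<not> 0 < f k ?v"
    using xy(4) k(1) unfolding l_def same k_def[symmetric] by (auto split: if_splits)
  then have "\<bar>f k ?u - f k ?v\<bar> \<ge> \<delta>"
    using k(2,3) \<open>\<delta> > 0\<close> by linarith
  moreover have "dist (f k ?u) (f k ?v) < \<delta>"
    using d(2)[OF k(1) v u] pt_close[OF xy(1,3)] e_le[OF k(1)] by simp
  ultimately show False
    by (simp add: dist_real_def)
qed

section \<open>Halving widths\<close>

text \<open>
  The support function of a set in the ball of radius \<open>B\<close> is \<open>B\<close>-Lipschitz, by Cauchy--Schwarz.
\<close>

lemma continuous_on_support:
  fixes A :: "'a::euclidean_space set"
  assumes "compact A" "A \<noteq> {}"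
  shows "continuous_on S (\<lambda>u. SUP x\<in>A. u \<bullet> x)"
proof -
  obtain B where B: "B > 0" "\<And>x. x \<in> A \<Longrightarrow> norm x \<le> B"
    using compact_imp_bounded[OF \<open>compact A\<close>] bounded_pos by metis
  have bdd: "bdd_above ((\<lambda>x. u \<bullet> x) ` A)" for u
    using \<open>compact A\<close> by (intro bounded_imp_bdd_above compact_imp_bounded compact_continuous_image continuous_intros)
  have le: "(SUP x\<in>A. u \<bullet> x) \<le> (SUP x\<in>A. v \<bullet> x) + B * dist u v" for u v
  proof (rule cSUP_least[OF \<open>A \<noteq> {}\<close>])
    fix x assume x: "x \<in> A"
    have "u \<bullet> x = v \<bullet> x + (u - v) \<bullet> x"
      by (simp add: inner_diff_left)
    also have "v \<bullet> x \<le> (SUP x\<in>A. v \<bullet> x)"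
      by (rule cSUP_upper[OF x bdd])
    also have "(u - v) \<bullet> x \<le> norm (u - v) * norm x"
      by (rule norm_cauchy_schwarz)
    also have "\<dots> \<le> norm (u - v) * B"
      by (intro mult_left_mono B(2) x) simp
    finally show "u \<bullet> x \<le> (SUP x\<in>A. v \<bullet> x) + B * dist u v"
      by (simp add: dist_norm mult.commute)
  qed
  have "B-lipschitz_on S (\<lambda>u. SUP x\<in>A. u \<bullet> x)"
  proof (rule lipschitz_onI)
    fix u v
    show "dist (SUP x\<in>A. u \<bullet> x) (SUP x\<in>A. v \<bullet> x) \<le> B * dist u v"
      using le[of u v] le[of v u] by (simp add: dist_real_def dist_commute abs_le_iff)
  qed (use B in simp)
  then show ?thesis
    by (rule lipschitz_on_continuous_on)
qed

lemma support_attained: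
  fixes A :: "'a::euclidean_space set"
  assumes "compact A" "A \<noteq> {}"
  obtains p where "p \<in> A" "\<And>x. x \<in> A \<Longrightarrow> u \<bullet> x \<le> u \<bullet> p" "(SUP x\<in>A. u \<bullet> x) = u \<bullet> p"
proof -
  have "continuous_on A (\<lambda>x. u \<bullet> x)"
    by (intro continuous_intros)
  then obtain p where p: "p \<in> A" "\<And>x. x \<in> A \<Longrightarrow> u \<bullet> x \<le> u \<bullet> p"
    using continuous_attains_sup[OF assms] by blast
  moreover have "(SUP x\<in>A. u \<bullet> x) = u \<bullet> p"
    by (rule cSup_eq_maximum) (use p in auto)
  ultimately show ?thesis
    by (rule that)
qed

text \<open>
  The linear functional has maximum \<open>fst w \<bullet> p\<close> and minimum \<open>fst w \<bullet> q\<close> on the convex hull, and takes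
  the value \<open>snd w\<close> half-way between them at the midpoint of \<open>p\<close> and \<open>q\<close>.  So this value is the
  minimum on one side and the maximum on the other, and both widths are half the total one.
\<close>

lemma widths_equal_if_midpoint:
  fixes A :: "(real ^ 'n) set"
  assumes p: "p \<in> A" "\<And>x. x \<in> A \<Longrightarrow> fst w \<bullet> x \<le> fst w \<bullet> p"
    and q: "q \<in> A" "\<And>x. x \<in> A \<Longrightarrow> fst w \<bullet> q \<le> fst w \<bullet> x"
    and mid: "fst w \<bullet> p + fst w \<bullet> q = 2 * snd w"
  shows "A \<inter> halfspace_pos w \<noteq> {} \<and> A \<inter> halfspace_neg w \<noteq> {} \<and>
      support_fun (fst w) (convex hull A \<inter> halfspace_pos w)
        - inf_support_fun (fst w) (convex hull A \<inter> halfspace_pos w)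
      = support_fun (fst w) (convex hull A \<inter> halfspace_neg w)
        - inf_support_fun (fst w) (convex hull A \<inter> halfspace_neg w)"
proof -
  let ?u = "fst w" and ?t = "snd w" and ?C = "convex hull A"
  have "?u \<bullet> q \<le> ?u \<bullet> p"
    using p q by blast
  then have order: "?u \<bullet> q \<le> ?t" "?t \<le> ?u \<bullet> p"
    using mid by linarith+
  have "?C \<subseteq> {x. ?u \<bullet> x \<le> ?u \<bullet> p} \<inter> {x. ?u \<bullet> x \<ge> ?u \<bullet> q}"
    by (intro hull_minimal convex_Int convex_halfspace_le convex_halfspace_ge) (use p q in auto)
  then have bounds: "?u \<bullet> q \<le> ?u \<bullet> x" "?u \<bullet> x \<le> ?u \<bullet> p" if "x \<in> ?C" for x
    using that by auto
  have hull: "p \<in> ?C" "q \<in> ?C"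
    using p q hull_inc by metis+
  define c where "c = midpoint p q"
  have c: "c \<in> ?C" "?u \<bullet> c = ?t"
    using convexD[OF convex_convex_hull hull, of "1/2" "1/2"] mid
    by (simp_all add: c_def midpoint_def inner_simps scaleR_add_right)
  have "support_fun ?u (?C \<inter> halfspace_pos w) = ?u \<bullet> p"
    unfolding support_fun_def
    by (rule Greatest_equality) (use hull order bounds in \<open>auto simp: halfspace_pos_def\<close>)
  moreover have "inf_support_fun ?u (?C \<inter> halfspace_pos w) = ?t"
    unfolding inf_support_fun_def
    by (rule Least_equality) (use c in \<open>auto simp: halfspace_pos_def intro!: image_eqI[of _ _ c]\<close>)
  moreover have "support_fun ?u (?C \<inter> halfspace_neg w) = ?t"
    unfolding support_fun_def
    by (rule Greatest_equality) (use c in \<open>auto simp: halfspace_neg_def intro!: image_eqI[of _ _ c]\<close>)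
  moreover have "inf_support_fun ?u (?C \<inter> halfspace_neg w) = ?u \<bullet> q"
    unfolding inf_support_fun_def
    by (rule Least_equality) (use hull order bounds in \<open>auto simp: halfspace_neg_def\<close>)
  moreover have "p \<in> A \<inter> halfspace_pos w" "q \<in> A \<inter> halfspace_neg w"
    using p q order by (auto simp: halfspace_pos_def halfspace_neg_def)
  ultimately show ?thesis
    using mid by auto
qed

theorem theorem4p2:
  fixes A :: "'n::finite \<Rightarrow> (real ^ 'n) set"
  assumes "\<And>i. compact (A i)"
    and "\<And>i. interior (convex hull (A i)) \<noteq> {}"
  shows "\<exists>w \<in> sphere (0 :: (real ^ 'n) \<times> real) 1. \<forall>i.
      A i \<inter> halfspace_pos w \<noteq> {} \<and> A i \<inter> halfspace_neg w \<noteq> {} \<and>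
      support_fun (fst w) (convex hull (A i) \<inter> halfspace_pos w)
        - inf_support_fun (fst w) (convex hull (A i) \<inter> halfspace_pos w)
      = support_fun (fst w) (convex hull (A i) \<inter> halfspace_neg w)
        - inf_support_fun (fst w) (convex hull (A i) \<inter> halfspace_neg w)"
proof -
  have ne: "A i \<noteq> {}" for i
    using assms(2)[of i] by auto
  define h where "h i u = (SUP x\<in>A i. u \<bullet> x)" for i u
  define c where "c i u = h i u - h i (- u)" for i u
  have cont_h: "continuous_on S (h i)" for i S
    unfolding h_def by (rule continuous_on_support[OF assms(1) ne])
  have cont_c: "continuous_on S (c i)" for i S
    unfolding c_def
    by (intro continuous_on_diff cont_h continuous_on_compose2[OF cont_h[of UNIV]] continuous_intros) auto
  have odd_c: "c i (- u) = - c i u" for i u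
    by (simp add: c_def)
  obtain e :: "nat \<Rightarrow> 'n" where e: "bij_betw e {0..<CARD('n)} UNIV"
    using ex_bij_betw_nat_finite[of "UNIV :: 'n set"] by auto
  have "\<exists>u\<in>sphere 0 1. \<forall>k\<in>{1..<CARD('n)}. c (e k) u - c (e 0) u = 0"
    by (rule borsuk_ulam) (simp_all add: continuous_on_diff cont_c odd_c)
  then obtain u where u: "norm u = 1" and zero: "\<And>k. k \<in> {1..<CARD('n)} \<Longrightarrow> c (e k) u = c (e 0) u"
    by auto
  define t where "t = c (e 0) u / 2"
  have ct: "c i u = 2 * t" for i
  proof -
    obtain k where k: "k < CARD('n)" "e k = i"
      using e unfolding bij_betw_def by (metis UNIV_I atLeastLessThan_iff imageE)
    then show ?thesis
      using zero[of k] by (cases "k = 0") (auto simp: t_def)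
  qed
  \<comment> \<open>The equations for \<open>(u, t)\<close> are homogeneous, so this point can be moved to the unit sphere.\<close>
  define w where "w = sgn (u, t)"
  define r where "r = inverse (norm (u, t))"
  have "(u, t) \<noteq> 0"
    using u by (auto simp: zero_prod_def)
  then have r: "r > 0" and "norm w = 1"
    by (simp_all add: w_def r_def norm_sgn)
  then have w: "norm w = 1" "fst w = r *\<^sub>R u" "snd w = r * t"
    by (simp_all add: w_def r_def sgn_div_norm)
  show ?thesis
  proof (intro bexI allI)
    show "w \<in> sphere 0 1"
      using w by simp
    fix i
    obtain p where p: "p \<in> A i" "\<And>x. x \<in> A i \<Longrightarrow> u \<bullet> x \<le> u \<bullet> p" "h i u = u \<bullet> p"
      unfolding h_def by (rule support_attained[OF assms(1)[of i] ne, where u = u]) blast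
    obtain q where q: "q \<in> A i" "\<And>x. x \<in> A i \<Longrightarrow> (- u) \<bullet> x \<le> (- u) \<bullet> q" "h i (- u) = (- u) \<bullet> q"
      unfolding h_def by (rule support_attained[OF assms(1)[of i] ne, where u = "- u"]) blast
    show "A i \<inter> halfspace_pos w \<noteq> {} \<and> A i \<inter> halfspace_neg w \<noteq> {} \<and>
      support_fun (fst w) (convex hull (A i) \<inter> halfspace_pos w)
        - inf_support_fun (fst w) (convex hull (A i) \<inter> halfspace_pos w)
      = support_fun (fst w) (convex hull (A i) \<inter> halfspace_neg w)
        - inf_support_fun (fst w) (convex hull (A i) \<inter> halfspace_neg w)"
    proof (rule widths_equal_if_midpoint)
      show "fst w \<bullet> p + fst w \<bullet> q = 2 * snd w"
        using ct[of i] p(3) q(3) unfolding c_def w by (simp flip: distrib_left)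
    qed (use p q r w in auto)
  qed
qed

end
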